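(* Let $T=(V,E)$ be a finite tree with at least one edge and let $w(t)$, $t\ge0$, be a solution of the normalized inverse-weight Ricci flow with positive initial metric. Let $w^*$ be an omega-limit point of $w$ and set $C=E^+(w^* )$. Then $$C\subseteq E_*,\qquad w^*|_C\in\mathcal S_C(c_* ).$$ Consequently, if $$\bigcup_{\varnothing\ne C\subseteq E_*}\mathcal S_C(c_* )$$ is finite, then $w(t)$ converges as $t\to\infty$. In particular, it is enough that $\mathcal S_C(c_* )$ contain at most one point for every nonempty $C\subseteq E_*$.
   Context: $T=(V,E)$ is a finite tree with at least one edge; $d_x$ is the combinatorial degree of $x\in V$ and $E(x)$ the set of edges incident to $x$. A positive metric is $w=(w_e)_{e\in E}$ with all $w_e>0$; it induces the path metric $d_w$ on $V$. Put $D_x(w)=\sum_{e\ni x}1/w_e$. For $\alpha\in[0,1)$ let $m_x^\alpha(x)=\alpha$ and $m_x^\alpha(z)=(1-\alpha)\,w_{xz}^{-1}/D_x(w)$ for $z\sim x$. The (inverse-weight) Lin--Lu--Yau curvature of $e=xy$ is $\kappa_e(w)=\lim_{\alpha\uparrow1}\frac{1-W_1(m_x^\alpha,m_y^\alpha)/w_e}{1-\alpha}$, with $W_1$ the $1$-Wasserstein distance for $d_w$. Known formula on trees: $\kappa_{xy}(w)=\frac{2-d_x}{w_{xy}D_x(w)}+\frac{2-d_y}{w_{xy}D_y(w)}$. The normalized flow is $\dot w_e=-w_e(\kappa_e(w)-K(w))$, $K(w)=\sum_f w_f\kappa_f(w)$, with $w_e(0)>0$ and $\sum_e w_e(0)=1$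 (this sum is preserved). For every positive initial metric the limits $c_e=\lim_{t\to\infty}\kappa_e(w(t))$ exist; put $c_*=\min_e c_e$ and $E_*=\{e\in E:c_e=c_*\}$. An omega-limit point of $w$ is a point $w^*\in\overline\Delta_E=\{q\in\mathbb R^E:q_e\ge0,\sum_e q_e=1\}$ such that $w(t_j)\to w^*$ for some sequence $t_j\to\infty$; its positive support is $E^+(w^* )=\{e\in E:w^*_e>0\}$. For nonempty $C\subseteq E$ let $\Delta_C=\{p\in\mathbb R^C:p_e>0\ \forall e\in C,\ \sum_{e\in C}p_e=1\}$, whose elements are identified with vectors in $\mathbb R^E$ by setting $p_e=0$ for $e\notin C$. For $p\in\Delta_C$ and $e\in C$ put $$\kappa_e^C(p)=\sum_{x\in e,\ E(x)\subseteq C}\frac{2-d_x}{p_e\sum_{f\in E(x)}p_f^{-1}},$$ and for $c\in\mathbb R$ let $\mathcal S_C(c)=\{p\in\Delta_C:\kappa_e^C(p)=c\text{ for every }e\in C\}$. *)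

theory Defs
  imports "HOL-Analysis.Analysis"
begin

text \<open>
  Undirected simple graphs are given by a vertex set \<open>V\<close> and a set \<open>E\<close> of two-element subsets of
  \<open>V\<close>.  Vectors in \<open>\<real>\<^sup>E\<close> are functions on \<open>'a set\<close>; where such vectors are collected in sets, they
  are required to vanish outside \<open>E\<close>, so that they correspond bijectively to points of \<open>\<real>\<^sup>E\<close>.
\<close>

definition simple_graph :: "'a set \<Rightarrow> 'a set set \<Rightarrow> bool" where
  "simple_graph V E \<longleftrightarrow> (\<forall>e\<in>E. \<exists>x\<in>V. \<exists>y\<in>V. x \<noteq> y \<and> e = {x, y})"

definition walk :: "'a set \<Rightarrow> 'a set set \<Rightarrow> 'a \<Rightarrow> 'a list \<Rightarrow> 'a \<Rightarrow> bool" where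
  "walk V E x p y \<longleftrightarrow> p \<noteq> [] \<and> set p \<subseteq> V \<and> hd p = x \<and> last p = y \<and>
     successively (\<lambda>u v. {u, v} \<in> E) p"

definition graph_connected :: "'a set \<Rightarrow> 'a set set \<Rightarrow> bool" where
  "graph_connected V E \<longleftrightarrow> V \<noteq> {} \<and> (\<forall>x\<in>V. \<forall>y\<in>V. \<exists>p. walk V E x p y)"

definition graph_cycle :: "'a set set \<Rightarrow> 'a list \<Rightarrow> bool" where
  "graph_cycle E p \<longleftrightarrow> 3 \<le> length p \<and> distinct p \<and>
     successively (\<lambda>u v. {u, v} \<in> E) p \<and> {last p, hd p} \<in> E"

definition finite_tree :: "'a set \<Rightarrow> 'a set set \<Rightarrow> bool" where
  "finite_tree V E \<longleftrightarrow> finite V \<and> simple_graph V E \<and> graph_connected V E \<and> (\<nexists>p. graph_cycle E p)"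

definition incident :: "'a set set \<Rightarrow> 'a \<Rightarrow> 'a set set" where
  "incident E x = {e \<in> E. x \<in> e}"

definition degree :: "'a set set \<Rightarrow> 'a \<Rightarrow> nat" where
  "degree E x = card (incident E x)"

definition positive_metric :: "'a set set \<Rightarrow> ('a set \<Rightarrow> real) \<Rightarrow> bool" where
  "positive_metric E w \<longleftrightarrow> (\<forall>e\<in>E. 0 < w e)"

definition walk_length :: "('a set \<Rightarrow> real) \<Rightarrow> 'a list \<Rightarrow> real" where
  "walk_length w p = (\<Sum>i<length p - 1. w {p ! i, p ! Suc i})"

definition path_metric :: "'a set \<Rightarrow> 'a set set \<Rightarrow> ('a set \<Rightarrow> real) \<Rightarrow> 'a \<Rightarrow> 'a \<Rightarrow> real" where
  "path_metric V E w x y = Inf {walk_length w p | p. walk V E x p y}"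

definition coupling :: "'a set \<Rightarrow> ('a \<Rightarrow> real) \<Rightarrow> ('a \<Rightarrow> real) \<Rightarrow> ('a \<Rightarrow> 'a \<Rightarrow> real) \<Rightarrow> bool" where
  "coupling V \<mu> \<nu> \<pi> \<longleftrightarrow> (\<forall>x\<in>V. \<forall>y\<in>V. 0 \<le> \<pi> x y) \<and>
     (\<forall>x\<in>V. (\<Sum>y\<in>V. \<pi> x y) = \<mu> x) \<and> (\<forall>y\<in>V. (\<Sum>x\<in>V. \<pi> x y) = \<nu> y)"

definition wasserstein1 ::
    "'a set \<Rightarrow> ('a \<Rightarrow> 'a \<Rightarrow> real) \<Rightarrow> ('a \<Rightarrow> real) \<Rightarrow> ('a \<Rightarrow> real) \<Rightarrow> real" where
  "wasserstein1 V d \<mu> \<nu> = Inf {(\<Sum>x\<in>V. \<Sum>y\<in>V. \<pi> x y * d x y) | \<pi>. coupling V \<mu> \<nu> \<pi>}"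

definition weighted_degree :: "'a set set \<Rightarrow> ('a set \<Rightarrow> real) \<Rightarrow> 'a \<Rightarrow> real" where
  "weighted_degree E w x = (\<Sum>e\<in>incident E x. 1 / w e)"

definition lazy_measure :: "'a set set \<Rightarrow> ('a set \<Rightarrow> real) \<Rightarrow> real \<Rightarrow> 'a \<Rightarrow> 'a \<Rightarrow> real" where
  "lazy_measure E w \<alpha> x z =
     (if z = x then \<alpha>
      else if {x, z} \<in> E then (1 - \<alpha>) * (1 / w {x, z}) / weighted_degree E w x
      else 0)"

definition lly_curvature :: "'a set \<Rightarrow> 'a set set \<Rightarrow> ('a set \<Rightarrow> real) \<Rightarrow> 'a \<Rightarrow> 'a \<Rightarrow> real" where
  "lly_curvature V E w x y = Lim (at_left 1)
     (\<lambda>\<alpha>. (1 - wasserstein1 V (path_metric V E w) (lazy_measure E w \<alpha> x) (lazy_measure E w \<alpha> y)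
               / w {x, y}) / (1 - \<alpha>))"

text \<open>
  The curvature is symmetric in the two endpoints, so it does not matter which
  orientation of the edge \<open>SOME\<close> picks.
\<close>

definition curvature :: "'a set \<Rightarrow> 'a set set \<Rightarrow> ('a set \<Rightarrow> real) \<Rightarrow> 'a set \<Rightarrow> real" where
  "curvature V E w e = (case (SOME (x, y). e = {x, y}) of (x, y) \<Rightarrow> lly_curvature V E w x y)"

definition mean_curvature :: "'a set \<Rightarrow> 'a set set \<Rightarrow> ('a set \<Rightarrow> real) \<Rightarrow> real" where
  "mean_curvature V E w = (\<Sum>f\<in>E. w f * curvature V E w f)"

text \<open>
  Positivity is only demanded at time \<open>0\<close>.  It persists, because the curvatures are bounded
  on the set of positive metrics, so that \<open>ln (w t e)\<close> cannot blow up in finite time.  Likewise the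
  normalization of the initial metric is preserved.
\<close>

definition normalized_flow ::
    "'a set \<Rightarrow> 'a set set \<Rightarrow> (real \<Rightarrow> 'a set \<Rightarrow> real) \<Rightarrow> bool" where
  "normalized_flow V E w \<longleftrightarrow>
     positive_metric E (w 0) \<and> (\<Sum>e\<in>E. w 0 e) = 1 \<and>
     (\<forall>t\<ge>0. \<forall>e\<in>E. ((\<lambda>s. w s e) has_real_derivative
        - w t e * (curvature V E (w t) e - mean_curvature V E (w t))) (at t within {0..}))"

text \<open>
  Both the limit defining \<open>lly_curvature\<close> and the one below exist on finite trees
  with positive metrics, resp. along solutions of the flow, so \<open>Lim\<close> is never used outside its domain.
\<close>

definition limit_curvature ::
    "'a set \<Rightarrow> 'a set set \<Rightarrow> (real \<Rightarrow> 'a set \<Rightarrow> real) \<Rightarrow> 'a set \<Rightarrow> real" where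
  "limit_curvature V E w e = Lim at_top (\<lambda>t. curvature V E (w t) e)"

definition min_limit_curvature ::
    "'a set \<Rightarrow> 'a set set \<Rightarrow> (real \<Rightarrow> 'a set \<Rightarrow> real) \<Rightarrow> real" where
  "min_limit_curvature V E w = Min (limit_curvature V E w ` E)"

definition min_curvature_edges ::
    "'a set \<Rightarrow> 'a set set \<Rightarrow> (real \<Rightarrow> 'a set \<Rightarrow> real) \<Rightarrow> 'a set set" where
  "min_curvature_edges V E w = {e \<in> E. limit_curvature V E w e = min_limit_curvature V E w}"

definition closed_simplex :: "'a set set \<Rightarrow> ('a set \<Rightarrow> real) set" where
  "closed_simplex E = {q. (\<forall>e\<in>E. 0 \<le> q e) \<and> (\<forall>e. e \<notin> E \<longrightarrow> q e = 0) \<and> (\<Sum>e\<in>E. q e) = 1}"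

definition open_simplex :: "'a set set \<Rightarrow> ('a set \<Rightarrow> real) set" where
  "open_simplex C = {p. (\<forall>e\<in>C. 0 < p e) \<and> (\<forall>e. e \<notin> C \<longrightarrow> p e = 0) \<and> (\<Sum>e\<in>C. p e) = 1}"

definition omega_limit_point ::
    "'a set set \<Rightarrow> (real \<Rightarrow> 'a set \<Rightarrow> real) \<Rightarrow> ('a set \<Rightarrow> real) \<Rightarrow> bool" where
  "omega_limit_point E w q \<longleftrightarrow> q \<in> closed_simplex E \<and>
     (\<exists>\<tau>::nat \<Rightarrow> real. filterlim \<tau> at_top sequentially \<and>
        (\<forall>e\<in>E. (\<lambda>j. w (\<tau> j) e) \<longlonglongrightarrow> q e))"

definition positive_support :: "'a set set \<Rightarrow> ('a set \<Rightarrow> real) \<Rightarrow> 'a set set" where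
  "positive_support E q = {e \<in> E. 0 < q e}"

definition restriction :: "('a set \<Rightarrow> real) \<Rightarrow> 'a set set \<Rightarrow> 'a set \<Rightarrow> real" where
  "restriction q C = (\<lambda>e. if e \<in> C then q e else 0)"

definition face_curvature ::
    "'a set set \<Rightarrow> 'a set set \<Rightarrow> ('a set \<Rightarrow> real) \<Rightarrow> 'a set \<Rightarrow> real" where
  "face_curvature E C p e = (\<Sum>x | x \<in> e \<and> incident E x \<subseteq> C.
     (2 - real (degree E x)) / (p e * (\<Sum>f\<in>incident E x. 1 / p f)))"

definition face_solutions :: "'a set set \<Rightarrow> 'a set set \<Rightarrow> real \<Rightarrow> ('a set \<Rightarrow> real) set" where
  "face_solutions E C c = {p \<in> open_simplex C. \<forall>e\<in>C. face_curvature E C p e = c}"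

definition flow_converges :: "'a set set \<Rightarrow> (real \<Rightarrow> 'a set \<Rightarrow> real) \<Rightarrow> bool" where
  "flow_converges E w \<longleftrightarrow> (\<exists>q. \<forall>e\<in>E. ((\<lambda>t. w t e) \<longlongrightarrow> q e) at_top)"

end

theory Submission
  imports Defs
begin

text \<open>
  In logarithmic coordinates \<open>s\<^sub>e = ln w\<^sub>e\<close> the unnormalized flow on a tree is \<open>s' = - \<nabla>\<Phi>(s)\<close> with
  \<open>\<Phi>(s) = \<Sum>\<^sub>x (d\<^sub>x - 2) ln (\<Sum>\<^sub>f exp (- s\<^sub>f))\<close>, where \<open>f\<close> ranges over the edges at \<open>x\<close>, and the
  curvature is \<open>\<nabla>\<Phi>\<close>.  Log-sum-exp is convex and the terms of the leaves are linear, so \<open>\<Phi>\<close> is convex;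
  the velocity of a convex gradient flow converges, hence so do the curvatures.  Edges whose limit
  curvature is not minimal lose against a minimal one exponentially fast and vanish in the limit,
  and on the support of an omega-limit point the curvatures pass to the limit.  If there are only
  finitely many candidates, an oscillating coordinate is impossible by the intermediate value theorem.
\<close>

subsection \<open>Curvature of trees\<close>

text \<open>Multiplying all weights by a common factor does not change the curvatures, so the term
  \<open>K\<close> of the normalized flow only shifts all logarithms by the same amount. Subtracting
  its integral from \<open>ln w\<close> leaves the unnormalized gradient flow. The obstacle is that
  this gradient flow has no equilibrium: the curvatures on a tree sum to
  \<open>2 |V| - 2 |E| = 2\<close>, so \<Phi> has no critical point and the logarithmic trajectory
  always escapes to infinity. Neither compactness nor descent to a minimizer is available, hence the
  argument about velocities, which uses only convexity and the energy identity. The transport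
  definition of curvature enters only through the closed formula on trees. That formula requires a
  positive metric, so positivity of the flow is established before anything else about it, while
  neither total mass nor continuity of the curvature can yet be used.\<close>

lemma rtrancl_obtain_distinct_path:
  assumes "(x, y) \<in> {(u, v). R u v}\<^sup>*"
  obtains p where "p \<noteq> []" "hd p = x" "last p = y" "distinct p" "successively R p"
proof -
  from assms have "\<exists>p. p \<noteq> [] \<and> hd p = x \<and> last p = y \<and> distinct p \<and> successively R p"
  proof (induction rule: rtrancl_induct)
    case base
    show ?case by (rule exI[of _ "[x]"]) auto
  next
    case (step y z)
    then obtain p where p: "p \<noteq> []" "hd p = x" "last p = y" "distinct p" "successively R p"
      by blast
    show ?case
    proof (cases "z \<in> set p")
      case True
      \<comment> \<open>Loop erasure: the path is cut at the earlier visit to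
        \<open>z\<close>.\<close>
      then obtain as bs where "p = as @ z # bs" by (meson split_list)
      with p show ?thesis
        by (intro exI[of _ "as @ [z]"]) (auto simp: successively_append_iff hd_append)
    next
      case False
      with p step show ?thesis
        by (intro exI[of _ "p @ [z]"]) (auto simp: successively_append_iff)
    qed
  qed
  with that show thesis by blast
qed

lemma simple_graph_edge:
  assumes "simple_graph V E" "{a, b} \<in> E"
  shows "a \<noteq> b" "a \<in> V" "b \<in> V"
  using assms by (auto simp: simple_graph_def doubleton_eq_iff dest!: bspec)

text \<open>A repetition-free path avoiding the edge would close up with it to a cycle. One vertex
  is excluded by \<open>a \<noteq> b\<close>, two vertices because the path would be the deleted
  edge itself.\<close>

lemma acyclic_edge_not_reachable:
  assumes "\<nexists>p. graph_cycle E p" "{a, b} \<in> E" "a \<noteq> b"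
  shows "(a, b) \<notin> {(u, v). {u, v} \<in> E - {{a, b}}}\<^sup>*"
proof
  assume "(a, b) \<in> {(u, v). {u, v} \<in> E - {{a, b}}}\<^sup>*"
  then obtain p where p: "p \<noteq> []" "hd p = a" "last p = b" "distinct p"
      "successively (\<lambda>u v. {u, v} \<in> E - {{a, b}}) p"
    by (rule rtrancl_obtain_distinct_path)
  have "length p \<noteq> 1"
    using p assms(3) by (auto simp: length_Suc_conv)
  moreover have "length p \<noteq> 2"
    using p by (auto simp: length_Suc_conv numeral_2_eq_2)
  moreover have "length p \<noteq> 0" using p by auto
  ultimately have "3 \<le> length p" by linarith
  moreover have "successively (\<lambda>u v. {u, v} \<in> E) p"
    using p(5) by (rule successively_mono) auto
  ultimately have "graph_cycle E p"
    using p assms(2) by (auto simp: graph_cycle_def insert_commute)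
  with assms(1) show False by blast
qed

text \<open>
  Deleting an edge \<open>f\<close> cuts the forest in two, and the indicator function of one side changes
  across \<open>f\<close> only; the potential is a combination of these indicator functions.
\<close>

lemma acyclic_antisymmetric_is_gradient:
  fixes r :: "'a \<Rightarrow> 'a \<Rightarrow> real"
  assumes acyc: "\<nexists>p. graph_cycle E p" and sg: "simple_graph V E" and fin: "finite E"
    and r: "\<And>a b. r b a = - r a b"
  obtains \<phi> where "\<And>a b. {a, b} \<in> E \<Longrightarrow> \<phi> a - \<phi> b = r a b"
proof -
  have "\<forall>f\<in>E. \<exists>a b. f = {a, b}"
    using sg by (fastforce simp: simple_graph_def)
  then obtain h l where hl: "\<And>f. f \<in> E \<Longrightarrow> f = {h f, l f}"
    by metis
  define R where "R f = {(u, v). {u, v} \<in> E - {f}}\<^sup>*" for f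
  \<comment> \<open>The indicator is that of the side of \<open>h f\<close>, so passing from
    \<open>h f\<close> to \<open>l f\<close> lowers the sum by \<open>r (h f) (l f)\<close>.
    Antisymmetry of \<open>r\<close> makes the arbitrary orientation harmless.\<close>
  define \<phi> where "\<phi> v = (\<Sum>f\<in>E. r (h f) (l f) * of_bool ((h f, v) \<in> R f))" for v
  have "\<phi> a - \<phi> b = r a b" if ab: "{a, b} \<in> E" for a b
  proof -
    let ?t = "\<lambda>f. r (h f) (l f) * (of_bool ((h f, a) \<in> R f) - of_bool ((h f, b) \<in> R f))"
    have stay: "(h f, a) \<in> R f \<longleftrightarrow> (h f, b) \<in> R f" if "f \<noteq> {a, b}" for f
    proof -
      have "(a, b) \<in> R f" "(b, a) \<in> R f"
        using ab that by (auto simp: R_def insert_commute intro!: r_into_rtrancl)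
      then show ?thesis
        unfolding R_def by (meson rtrancl_trans)
    qed
    have "\<phi> a - \<phi> b = (\<Sum>f\<in>E. ?t f)"
      by (simp add: \<phi>_def right_diff_distrib sum_subtractf)
    also have "\<dots> = ?t {a, b}"
      using ab fin stay by (subst sum.remove[OF fin ab]) (auto intro!: sum.neutral)
    also have "\<dots> = r a b"
    proof -
      have neq: "a \<noteq> b" using simple_graph_edge[OF sg ab] by blast
      have 1: "(a, b) \<notin> R {a, b}" "(b, a) \<notin> R {a, b}"
        using acyclic_edge_not_reachable[OF acyc ab neq]
          acyclic_edge_not_reachable[OF acyc, of b a] ab neq
        by (auto simp: R_def insert_commute)
      have 2: "(v, v) \<in> R f" for v f by (simp add: R_def)
      have "h {a, b} = a \<and> l {a, b} = b \<or> h {a, b} = b \<and> l {a, b} = a"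
        using hl[OF ab] by (auto simp: doubleton_eq_iff)
      then show ?thesis using 1 2 r[of a b] by (auto simp: r[of b a])
    qed
    finally show ?thesis .
  qed
  with that show thesis by blast
qed

section \<open>Path metric and lazy walk measures\<close>

lemma walk_length_Cons_Cons:
  "walk_length w (a # b # p) = w {a, b} + walk_length w (b # p)"
  by (simp add: walk_length_def lessThan_Suc_eq_insert_0 sum.reindex del: sum.lessThan_Suc)

lemma walk_length_ge:
  assumes "successively (\<lambda>u v. {u, v} \<in> E) p" "p \<noteq> []"
    and "\<And>a b. {a, b} \<in> E \<Longrightarrow> \<phi> a - \<phi> b \<le> w {a, b}"
  shows "\<phi> (hd p) - \<phi> (last p) \<le> walk_length w p"
  using assms(1,2)
proof (induction p rule: induct_list012)
  case (2 x)
  then show ?case by (simp add: walk_length_def)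
next
  case (3 x y zs)
  then show ?case
    using assms(3)[of x y] by (auto simp: walk_length_Cons_Cons)
qed simp

text \<open>An edgewise Lipschitz bound telescopes along every walk; connectedness ensures that the
  infimum is over a nonempty set. This is the source of the easy half of Kantorovich
  duality.\<close>

lemma path_metric_ge:
  assumes "graph_connected V E" "x \<in> V" "y \<in> V"
    and "\<And>a b. {a, b} \<in> E \<Longrightarrow> \<phi> a - \<phi> b \<le> w {a, b}"
  shows "\<phi> x - \<phi> y \<le> path_metric V E w x y"
  unfolding path_metric_def
proof (rule cInf_greatest)
  show "{walk_length w p |p. walk V E x p y} \<noteq> {}"
    using assms by (auto simp: graph_connected_def)
next
  fix l assume "l \<in> {walk_length w p |p. walk V E x p y}"
  then show "\<phi> x - \<phi> y \<le> l"
    using walk_length_ge[of E _ \<phi> w] assms(4) by (auto simp: walk_def)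
qed

lemma path_metric_le:
  assumes "positive_metric E w" "walk V E x p y"
  shows "path_metric V E w x y \<le> walk_length w p"
  unfolding path_metric_def
proof (rule cInf_lower)
  show "bdd_below {walk_length w p |p. walk V E x p y}"
  proof (rule bdd_belowI)
    fix l assume "l \<in> {walk_length w p |p. walk V E x p y}"
    then show "0 \<le> l"
      using walk_length_ge[of E _ "\<lambda>_. 0" w] assms(1)
      by (auto simp: walk_def positive_metric_def intro: less_imp_le)
  qed
qed (use assms in auto)

lemma finite_edges:
  assumes "simple_graph V E" "finite V"
  shows "finite E"
proof (rule finite_subset)
  show "E \<subseteq> Pow V" using assms by (fastforce simp: simple_graph_def)
qed (use assms in auto)

lemma sum_neighbours:
  assumes "simple_graph V E"
  shows "(\<Sum>z | {x, z} \<in> E. g {x, z}) = (\<Sum>f\<in>incident E x. g f)"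
proof -
  have "bij_betw (\<lambda>z. {x, z}) {z. {x, z} \<in> E} (incident E x)"
    unfolding bij_betw_def
  proof
    show "inj_on (\<lambda>z. {x, z}) {z. {x, z} \<in> E}"
      by (auto simp: inj_on_def doubleton_eq_iff)
    show "(\<lambda>z. {x, z}) ` {z. {x, z} \<in> E} = incident E x"
      using assms
      by (auto simp: incident_def simple_graph_def image_iff) (metis insert_commute insertE singletonD)
  qed
  then show ?thesis by (rule sum.reindex_bij_betw)
qed

lemma weighted_degree_pos:
  assumes "finite E" "positive_metric E w" "e \<in> E" "x \<in> e"
  shows "0 < weighted_degree E w x"
  unfolding weighted_degree_def
  by (rule sum_pos2[of _ e]) (use assms in \<open>auto simp: incident_def positive_metric_def intro: less_imp_le\<close>)

text \<open>Separates the atom at \<open>x\<close> from the neighbours. With \<open>g\<close>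
  constant it yields the total mass, with \<open>g\<close> a difference of potentials the first
  moment in the transport computation.\<close>

lemma sum_lazy_measure:
  assumes "finite V" "simple_graph V E" "x \<in> V"
  shows "(\<Sum>v\<in>V. lazy_measure E w \<alpha> x v * g v) =
    \<alpha> * g x + (1 - \<alpha>) / weighted_degree E w x * (\<Sum>z | {x, z} \<in> E. 1 / w {x, z} * g z)"
proof -
  note E = simple_graph_edge[OF assms(2)]
  have "(\<Sum>v\<in>V. lazy_measure E w \<alpha> x v * g v) =
      \<alpha> * g x + (\<Sum>v\<in>V - {x}. lazy_measure E w \<alpha> x v * g v)"
    using assms by (subst sum.remove[of V x]) (auto simp: lazy_measure_def)
  also have "(\<Sum>v\<in>V - {x}. lazy_measure E w \<alpha> x v * g v) =
      (\<Sum>z | {x, z} \<in> E. (1 - \<alpha>) / weighted_degree E w x * (1 / w {x, z} * g z))"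
    using assms E by (intro sum.mono_neutral_cong_right) (auto simp: lazy_measure_def)
  finally show ?thesis by (simp add: sum_distrib_left)
qed

lemma sum_lazy_measure_eq_1:
  assumes "finite V" "simple_graph V E" "positive_metric E w" "{x, y} \<in> E"
  shows "(\<Sum>v\<in>V. lazy_measure E w \<alpha> x v) = 1"
proof -
  have "weighted_degree E w x > 0"
    using weighted_degree_pos[OF finite_edges[OF assms(2,1)] assms(3,4)] by simp
  moreover have "(\<Sum>z | {x, z} \<in> E. 1 / w {x, z}) = weighted_degree E w x"
    using sum_neighbours[OF assms(2), where g = "\<lambda>f. 1 / w f"] by (simp add: weighted_degree_def)
  ultimately show ?thesis
    using sum_lazy_measure[OF assms(1,2) simple_graph_edge(2)[OF assms(2,4)], of w \<alpha> "\<lambda>_. 1"] by simp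
qed

lemma lazy_measure_nonneg:
  assumes "finite E" "positive_metric E w" "0 \<le> \<alpha>" "\<alpha> \<le> 1"
  shows "0 \<le> lazy_measure E w \<alpha> x z"
  using assms weighted_degree_pos[OF assms(1,2), of "{x, z}" x]
  by (auto simp: lazy_measure_def positive_metric_def intro!: divide_nonneg_pos mult_pos_pos)

text \<open>
  Orient every edge at \<open>x\<close> and \<open>y\<close> along the transport from the neighbours of \<open>x\<close> through \<open>xy\<close> to
  the neighbours of \<open>y\<close>.  A potential that decreases with slope \<open>1\<close> along these edges is dual to the
  coupling that moves each mass along its unique path, and complementary slackness shows that both
  are optimal.
\<close>

lemma wasserstein1_lazy_measure:
  assumes tree: "finite_tree V E" and pos: "positive_metric E w" and xy: "{x, y} \<in> E"
    and \<alpha>: "1 / 2 \<le> \<alpha>" "\<alpha> \<le> 1"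
  shows "wasserstein1 V (path_metric V E w) (lazy_measure E w \<alpha> x) (lazy_measure E w \<alpha> y) =
    w {x, y} + (1 - \<alpha>) * ((real (degree E x) - 2) / weighted_degree E w x
      + (real (degree E y) - 2) / weighted_degree E w y)"
proof -
  have fin: "finite V" and sg: "simple_graph V E" and con: "graph_connected V E"
    and acyc: "\<nexists>p. graph_cycle E p"
    using tree by (auto simp: finite_tree_def)
  have finE: "finite E" using finite_edges[OF sg fin] .
  note edge = simple_graph_edge[OF sg]
  have xyV: "x \<in> V" "y \<in> V" and neq: "x \<noteq> y" using edge[OF xy] by auto
  have yx: "{y, x} \<in> E" using xy by (simp add: insert_commute)
  have wpos: "0 < w f" if "f \<in> E" for f using pos that by (auto simp: positive_metric_def)
  \<comment> \<open>\<open>\<eta> a b\<close> marks the arcs into \<open>x\<close>, out of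
    \<open>y\<close> and from \<open>x\<close> to \<open>y\<close>. Edges meeting neither endpoint
    get slope 0, as no mass crosses them.\<close>
  define \<eta> :: "'a \<Rightarrow> 'a \<Rightarrow> real" where "\<eta> a b = of_bool (b = x \<and> a \<noteq> y) + of_bool (a = y \<and> b \<noteq> x)
    + of_bool (a = x \<and> b = y)" for a b
  define r where "r a b = w {a, b} * (\<eta> a b - \<eta> b a)" for a b
  have antisym: "r b a = - r a b" for a b
    by (simp add: r_def insert_commute algebra_simps)
  obtain \<phi> where \<phi>: "\<And>a b. {a, b} \<in> E \<Longrightarrow> \<phi> a - \<phi> b = r a b"
    using acyclic_antisymmetric_is_gradient[where r = r, OF acyc sg finE antisym] by metis
  have "\<bar>\<eta> a b - \<eta> b a\<bar> \<le> 1" if "a \<noteq> b" for a b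
    using neq that unfolding \<eta>_def of_bool_def by (cases "a = x"; cases "a = y"; cases "b = x"; cases "b = y") simp_all
  then have lip: "\<phi> a - \<phi> b \<le> w {a, b}" if "{a, b} \<in> E" for a b
    using mult_left_mono[OF abs_le_D1 less_imp_le[OF wpos[OF that]], of "\<eta> a b - \<eta> b a" 1] edge(1)[OF that]
    unfolding \<phi>[OF that] r_def by simp
  have \<phi>xy: "\<phi> x - \<phi> y = w {x, y}"
    using neq by (simp add: \<phi>[OF xy] r_def \<eta>_def)
  have \<phi>x: "\<phi> z - \<phi> x = w {x, z}" if "{x, z} \<in> E" "z \<noteq> y" for z
    using neq that edge(1)[of x z] \<phi>[of z x] by (auto simp: r_def \<eta>_def insert_commute)
  have \<phi>y: "\<phi> y - \<phi> u = w {y, u}" if "{y, u} \<in> E" "u \<noteq> x" for u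
    using neq that edge(1)[of y u] \<phi>[of y u] by (auto simp: r_def \<eta>_def)
  let ?d = "path_metric V E w" and ?m = "lazy_measure E w \<alpha>"
  let ?W = "(\<Sum>a\<in>V. ?m x a * \<phi> a) - (\<Sum>b\<in>V. ?m y b * \<phi> b)"
  \<comment> \<open>The integral of a difference of potentials sees only the marginals, so it has
    the same value for every coupling.\<close>
  have cost_\<phi>: "(\<Sum>a\<in>V. \<Sum>b\<in>V. \<pi> a b * (\<phi> a - \<phi> b)) = ?W" if "coupling V (?m x) (?m y) \<pi>" for \<pi>
  proof -
    have "(\<Sum>a\<in>V. \<Sum>b\<in>V. \<pi> a b * (\<phi> a - \<phi> b)) =
        (\<Sum>a\<in>V. \<Sum>b\<in>V. \<pi> a b * \<phi> a) - (\<Sum>b\<in>V. \<Sum>a\<in>V. \<pi> a b * \<phi> b)"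
      by (subst sum.swap[of _ V V]) (simp add: right_diff_distrib sum_subtractf)
    also have "\<dots> = ?W"
      using that by (simp add: coupling_def flip: sum_distrib_right)
    finally show ?thesis .
  qed
  have lower: "?W \<le> (\<Sum>a\<in>V. \<Sum>b\<in>V. \<pi> a b * ?d a b)" if c: "coupling V (?m x) (?m y) \<pi>" for \<pi>
    unfolding cost_\<phi>[OF c, symmetric]
    using c path_metric_ge[where \<phi> = \<phi> and w = w, OF con _ _ lip]
    by (intro sum_mono mult_left_mono) (auto simp: coupling_def)
  \<comment> \<open>All mass of \<open>?m x\<close> off \<open>x\<close> goes to \<open>y\<close>,
    and all mass of \<open>?m y\<close> off \<open>y\<close> comes from \<open>x\<close>. Of the
    atom \<alpha> at \<open>x\<close> this leaves \<open>\<alpha> - (1 - \<alpha>)\<close> for the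
    pair \<open>x\<close>, \<open>y\<close>, which is nonnegative because
    \<open>1 / 2 \<le> \<alpha>\<close>.\<close>
  define \<pi> where "\<pi> a b = (if a = x \<and> b = y then 2 * \<alpha> - 1 else if b = y then ?m x a
    else if a = x then ?m y b else 0)" for a b
  have m_nn: "0 \<le> ?m v z" for v z
    using lazy_measure_nonneg[OF finE pos] \<alpha> by simp
  have mself: "?m v v = \<alpha>" for v by (simp add: lazy_measure_def)
  have coup: "coupling V (?m x) (?m y) \<pi>"
    unfolding coupling_def
  proof (intro conjI ballI)
    fix a b show "0 \<le> \<pi> a b" using \<alpha> m_nn by (simp add: \<pi>_def)
  next
    fix a assume a: "a \<in> V"
    show "(\<Sum>b\<in>V. \<pi> a b) = ?m x a"
    proof (cases "a = x")
      case True
      then have "(\<Sum>b\<in>V. \<pi> a b) = 2 * \<alpha> - 1 + (\<Sum>b\<in>V - {y}. ?m y b)"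
        using fin xyV by (subst sum.remove[of V y]) (auto simp: \<pi>_def)
      also have "(\<Sum>b\<in>V - {y}. ?m y b) = 1 - \<alpha>"
        using sum_lazy_measure_eq_1[OF fin sg pos yx, of \<alpha>] fin xyV
        by (subst (asm) sum.remove[of V y]) (auto simp: mself)
      finally show ?thesis using True by (simp add: mself)
    next
      case False
      then have "(\<Sum>b\<in>V. \<pi> a b) = (\<Sum>b\<in>V. if b = y then ?m x a else 0)"
        by (intro sum.cong) (auto simp: \<pi>_def)
      then show ?thesis using fin xyV by simp
    qed
  next
    fix b assume b: "b \<in> V"
    show "(\<Sum>a\<in>V. \<pi> a b) = ?m y b"
    proof (cases "b = y")
      case True
      then have "(\<Sum>a\<in>V. \<pi> a b) = 2 * \<alpha> - 1 + (\<Sum>a\<in>V - {x}. ?m x a)"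
        using fin xyV by (subst sum.remove[of V x]) (auto simp: \<pi>_def)
      also have "(\<Sum>a\<in>V - {x}. ?m x a) = 1 - \<alpha>"
        using sum_lazy_measure_eq_1[OF fin sg pos xy, of \<alpha>] fin xyV
        by (subst (asm) sum.remove[of V x]) (auto simp: mself)
      finally show ?thesis using True by (simp add: mself)
    next
      case False
      then have "(\<Sum>a\<in>V. \<pi> a b) = (\<Sum>a\<in>V. if a = x then ?m y b else 0)"
        by (intro sum.cong) (auto simp: \<pi>_def)
      then show ?thesis using fin xyV by simp
    qed
  qed
  \<comment> \<open>Explicit walks bound the distances from above; the matching lower bound on the
    cost comes from the potential.\<close>
  have d_refl: "?d v v \<le> 0" if "v \<in> V" for v
    using path_metric_le[OF pos, of V v "[v]" v] that by (simp add: walk_def walk_length_def)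
  have d_xy: "?d x y \<le> w {x, y}"
    using path_metric_le[OF pos, of V x "[x, y]" y] xy xyV
    by (simp add: walk_def walk_length_def)
  have d_zy: "?d z y \<le> w {x, z} + w {x, y}" if "{x, z} \<in> E" for z
    using path_metric_le[OF pos, of V z "[z, x, y]" y] xy xyV that edge[OF that]
    by (simp add: walk_def walk_length_Cons_Cons insert_commute) (simp add: walk_length_def)
  have d_xu: "?d x u \<le> w {x, y} + w {y, u}" if "{y, u} \<in> E" for u
    using path_metric_le[OF pos, of V x "[x, y, u]" u] xy xyV that edge[OF that]
    by (simp add: walk_def walk_length_Cons_Cons insert_commute) (simp add: walk_length_def)
  have slack: "\<pi> a b * ?d a b \<le> \<pi> a b * (\<phi> a - \<phi> b)" if "a \<in> V" "b \<in> V" for a b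
  proof -
    have "\<pi> a b = 0 \<or> ?d a b \<le> \<phi> a - \<phi> b"
    proof (cases "\<pi> a b = 0")
      case False
      then consider "a = x" "b = y" | "b = y" "a \<noteq> x" "{x, a} \<in> E" | "a = x" "b \<noteq> y" "{y, b} \<in> E"
        by (auto simp: \<pi>_def lazy_measure_def split: if_splits)
      then show ?thesis
      proof cases
        case 1
        then show ?thesis using d_xy \<phi>xy by simp
      next
        case 2
        \<comment> \<open>For \<open>a = y\<close> the mass that \<open>?m x\<close> already has at
          \<open>y\<close> stays in place; likewise \<open>b = x\<close> in the third case.\<close>
        then show ?thesis using d_zy[of a] \<phi>x[of a] \<phi>xy d_refl[of y] xyV by (cases "a = y") auto
      next
        case 3
        then show ?thesis using d_xu[of b] \<phi>y[of b] \<phi>xy d_refl[of x] xyV by (cases "b = x") auto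
      qed
    qed simp
    moreover have "0 \<le> \<pi> a b" using coup that by (auto simp: coupling_def)
    ultimately show ?thesis by (auto intro: mult_left_mono)
  qed
  have "(\<Sum>a\<in>V. \<Sum>b\<in>V. \<pi> a b * ?d a b) \<le> ?W"
    unfolding cost_\<phi>[OF coup, symmetric] by (intro sum_mono slack)
  with lower[OF coup] have cost: "?W = (\<Sum>a\<in>V. \<Sum>b\<in>V. \<pi> a b * ?d a b)" by simp
  have "wasserstein1 V ?d (?m x) (?m y) = ?W"
    unfolding wasserstein1_def
  proof (rule cInf_eq_minimum)
    show "?W \<in> {\<Sum>x\<in>V. \<Sum>y\<in>V. \<pi> x y * ?d x y |\<pi>. coupling V (?m x) (?m y) \<pi>}"
      unfolding mem_Collect_eq by (rule exI[of _ \<pi>]) (use coup cost in simp)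
  qed (use lower in auto)
  also have "?W = w {x, y} + (1 - \<alpha>) * ((real (degree E x) - 2) / weighted_degree E w x
      + (real (degree E y) - 2) / weighted_degree E w y)"
  proof -
    have finN: "finite {z. {v, z} \<in> E}" for v
      by (rule finite_subset[OF _ fin]) (use edge in auto)
    have card: "real (card {z. {v, z} \<in> E}) = real (degree E v)" for v
      using sum_neighbours[OF sg, where x = v and g = "\<lambda>_. 1::real"] by (simp add: degree_def)
    \<comment> \<open>The slopes cancel the weights: each neighbour of \<open>p\<close> contributes
      \<sigma>, except \<open>q\<close> with \<open>- \<sigma>\<close>, which gives \<sigma> times
      the degree minus 2. The sign \<sigma> is 1 at \<open>x\<close> and -1 at
      \<open>y\<close>.\<close>
    have moment: "(\<Sum>v\<in>V. ?m p v * \<phi> v) =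
        \<phi> p + (1 - \<alpha>) * (\<sigma> * (real (degree E p) - 2) / weighted_degree E w p)"
      if pq: "{p, q} \<in> E"
        and \<sigma>: "\<And>z. {p, z} \<in> E \<Longrightarrow> \<phi> z - \<phi> p = (if z = q then - \<sigma> else \<sigma>) * w {p, z}"
      for p q and \<sigma> :: real
    proof -
      have "(\<Sum>v\<in>V. ?m p v * \<phi> v) = (\<Sum>v\<in>V. ?m p v * (\<phi> v - \<phi> p)) + (\<Sum>v\<in>V. ?m p v) * \<phi> p"
        by (simp add: right_diff_distrib sum_subtractf sum_distrib_right)
      also have "\<dots> = \<phi> p + (1 - \<alpha>) / weighted_degree E w p *
          (\<Sum>z | {p, z} \<in> E. 1 / w {p, z} * (\<phi> z - \<phi> p))"
        using sum_lazy_measure[OF fin sg edge(2)[OF pq]] sum_lazy_measure_eq_1[OF fin sg pos pq]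
        by simp
      also have "(\<Sum>z | {p, z} \<in> E. 1 / w {p, z} * (\<phi> z - \<phi> p)) =
          (\<Sum>z | {p, z} \<in> E. if z = q then - \<sigma> else \<sigma>)"
      proof (intro sum.cong refl)
        fix z assume "z \<in> {z. {p, z} \<in> E}"
        then show "1 / w {p, z} * (\<phi> z - \<phi> p) = (if z = q then - \<sigma> else \<sigma>)"
          using \<sigma>[of z] wpos[of "{p, z}"] by simp
      qed
      also have "\<dots> = (\<Sum>z | {p, z} \<in> E. \<sigma> - (if z = q then 2 * \<sigma> else 0))"
        by (intro sum.cong) auto
      also have "\<dots> = \<sigma> * (real (degree E p) - 2)"
        using pq finN[of p] card[of p] by (simp add: sum_subtractf algebra_simps)
      finally show ?thesis by simp
    qed
    have mx: "(\<Sum>v\<in>V. ?m x v * \<phi> v) =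
        \<phi> x + (1 - \<alpha>) * (1 * (real (degree E x) - 2) / weighted_degree E w x)"
      by (rule moment[OF xy]) (use \<phi>x \<phi>xy in auto)
    have my: "(\<Sum>v\<in>V. ?m y v * \<phi> v) =
        \<phi> y + (1 - \<alpha>) * (- 1 * (real (degree E y) - 2) / weighted_degree E w y)"
    proof (rule moment[OF yx])
      fix z assume "{y, z} \<in> E"
      then show "\<phi> z - \<phi> y = (if z = x then - (- 1) else - 1) * w {y, z}"
        using \<phi>y[of z] \<phi>xy by (cases "z = x") (simp_all add: insert_commute)
    qed
    show ?thesis unfolding mx my using \<phi>xy by (simp add: algebra_simps add_divide_distrib diff_divide_distrib)
  qed
  finally show ?thesis .
qed

text \<open>The transport cost is affine in \<alpha> near 1, so the quotient is constant there and
  the limit is that constant.\<close>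

lemma lly_curvature_tree:
  assumes tree: "finite_tree V E" and pos: "positive_metric E w" and xy: "{x, y} \<in> E"
  shows "lly_curvature V E w x y =
    (2 - real (degree E x)) / (w {x, y} * weighted_degree E w x)
    + (2 - real (degree E y)) / (w {x, y} * weighted_degree E w y)"
    (is "_ = ?k")
proof -
  let ?q = "\<lambda>\<alpha>. (1 - wasserstein1 V (path_metric V E w) (lazy_measure E w \<alpha> x) (lazy_measure E w \<alpha> y)
      / w {x, y}) / (1 - \<alpha>)"
  have arith: "(1 - (p + b * A) / p) / b = - A / p" if "p \<noteq> 0" "b \<noteq> 0" for p b A :: real
    using that by (simp add: field_simps)
  have w: "w {x, y} > 0" using pos xy by (auto simp: positive_metric_def)
  have "eventually (\<lambda>\<alpha>. \<alpha> \<in> {1/2<..<1}) (at_left (1::real))"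
    by (rule eventually_at_leftI[of "1/2"]) auto
  then have "eventually (\<lambda>\<alpha>. ?q \<alpha> = ?k) (at_left 1)"
  proof eventually_elim
    case (elim \<alpha>)
    let ?A = "(real (degree E x) - 2) / weighted_degree E w x + (real (degree E y) - 2) / weighted_degree E w y"
    have "?q \<alpha> = (1 - (w {x, y} + (1 - \<alpha>) * ?A) / w {x, y}) / (1 - \<alpha>)"
      using elim by (subst wasserstein1_lazy_measure[OF assms]) simp_all
    also have "\<dots> = - ?A / w {x, y}"
      using arith[of "w {x, y}" "1 - \<alpha>" ?A] elim w by simp
    also have "\<dots> = ?k"
      by (simp add: add_divide_distrib diff_divide_distrib mult.commute)
    finally show ?case .
  qed
  then have "(?q \<longlongrightarrow> ?k) (at_left 1)" by (rule tendsto_eventually)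
  then show ?thesis unfolding lly_curvature_def by (intro tendsto_Lim) simp_all
qed

text \<open>With the full edge set as face, no endpoint is dropped and \<open>face_curvature\<close>
  is the closed tree formula. Its symmetry in the endpoints absorbs the choice made by
  \<open>SOME\<close>.\<close>

lemma curvature_tree:
  assumes tree: "finite_tree V E" and pos: "positive_metric E w" and e: "e \<in> E"
  shows "curvature V E w e = face_curvature E E w e"
proof -
  obtain a b where "e = {a, b}"
    using tree e by (fastforce simp: finite_tree_def simple_graph_def)
  then have "\<exists>p. case p of (x, y) \<Rightarrow> e = {x, y}" by auto
  then have "case (SOME (x, y). e = {x, y}) of (x, y) \<Rightarrow> e = {x, y}" by (rule someI_ex)
  then obtain x y where xy: "(SOME (x, y). e = {x, y}) = (x, y)" "e = {x, y}"
    by (auto split: prod.splits)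
  have "x \<noteq> y" using tree e xy(2) simple_graph_edge(1)[of V E x y] by (auto simp: finite_tree_def)
  moreover have "{v. v \<in> e \<and> incident E v \<subseteq> E} = {x, y}" using xy(2) by (auto simp: incident_def)
  ultimately show ?thesis
    using xy lly_curvature_tree[OF tree pos, of x y] e
    by (simp add: curvature_def face_curvature_def weighted_degree_def)
qed

subsection \<open>Convex gradient flows\<close>

text \<open>At 0 the derivative is one-sided, so only continuity is used there; at interior points
  it is two-sided.\<close>

lemma nonincreasing_on_halfline:
  fixes f f' :: "real \<Rightarrow> real"
  assumes der: "\<And>t. 0 \<le> t \<Longrightarrow> (f has_real_derivative f' t) (at t within {0..})"
    and nonpos: "\<And>t. 0 \<le> t \<Longrightarrow> f' t \<le> 0" and "0 \<le> a" "a \<le> b"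
  shows "f b \<le> f a"
proof (rule DERIV_nonpos_imp_decreasing_open[OF \<open>a \<le> b\<close>])
  fix x assume "a < x" "x < b"
  then have "at x within {0..} = at x"
    using \<open>0 \<le> a\<close> by (intro at_within_interior) (auto simp: interior_Ici[of _ "- 1"])
  with der[of x] nonpos[of x] \<open>0 \<le> a\<close> \<open>a < x\<close>
  show "\<exists>y. (f has_real_derivative y) (at x) \<and> y \<le> 0" by auto
next
  have "continuous_on {0..} f"
    using der by (auto simp: continuous_on_eq_continuous_within intro: DERIV_continuous)
  then show "continuous_on {a..b} f"
    by (rule continuous_on_subset) (use \<open>0 \<le> a\<close> in auto)
qed

lemma DERIV_shift_halfline:
  fixes f :: "real \<Rightarrow> real"
  assumes "(f has_real_derivative D) (at (t + h) within {0..})" "0 \<le> h"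
  shows "((\<lambda>t. f (t + h)) has_real_derivative D) (at t within {0..})"
proof -
  have "(f has_real_derivative D) (at (t + h) within (\<lambda>t. t + h) ` {0..})"
    by (rule has_field_derivative_subset[OF assms(1)]) (use assms(2) in auto)
  moreover have "((\<lambda>t. t + h) has_real_derivative 1) (at t within {0..})"
    by (auto intro!: derivative_eq_intros)
  ultimately show ?thesis
    using DERIV_image_chain[of f D "\<lambda>t. t + h" t "{0..}" 1] by (simp add: o_def)
qed

lemma sum_mult_le_of_sum_squares:
  fixes v g :: "'i \<Rightarrow> real"
  assumes "(\<Sum>i\<in>I. (g i)\<^sup>2) \<le> c\<^sup>2" "0 < c"
  shows "(\<Sum>i\<in>I. v i * g i) \<le> L2_set v I * c"
proof -
  have "(\<Sum>i\<in>I. v i * g i) \<le> (\<Sum>i\<in>I. \<bar>v i\<bar> * \<bar>g i\<bar>)"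
    by (intro sum_mono) (simp flip: abs_mult)
  also have "\<dots> \<le> L2_set v I * L2_set g I" by (rule L2_set_mult_ineq)
  also have "\<dots> \<le> L2_set v I * c"
    using assms by (intro mult_left_mono L2_set_nonneg)
      (auto simp: L2_set_def intro!: real_le_lsqrt sum_nonneg)
  finally show ?thesis .
qed

text \<open>
  The gradient flow of a convex function on \<open>\<real>\<^sup>I\<close> has a converging velocity.  With
  \<open>\<rho>\<close> the limit of the decreasing function \<open>|g|\<^sup>2\<close>, convexity and the energy identity give
  \<open>\<langle>g(t), s(t) - s(t + h)\<rangle> \<ge> h \<rho>\<close>, whereas \<open>|s(t) - s(t + h)| \<le> h |g(t)|\<close>.  So the difference quotient
  \<open>(s(t) - s(t + h)) / h\<close> differs from \<open>g(t)\<close> by at most \<open>sqrt (2 |g(t)|\<^sup>2 - 2 \<rho>)\<close>, uniformly in \<open>h\<close>.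
  Since for \<open>h \<rightarrow> \<infinity>\<close> these quotients forget the initial time, \<open>g\<close> is Cauchy.
\<close>

locale convex_gradient_flow =
  fixes I :: "'i set" and \<Phi> :: "('i \<Rightarrow> real) \<Rightarrow> real" and G :: "('i \<Rightarrow> real) \<Rightarrow> 'i \<Rightarrow> real"
    and s :: "real \<Rightarrow> 'i \<Rightarrow> real"
  assumes finite_I: "finite I"
    and flow: "\<And>t i. \<lbrakk>0 \<le> t; i \<in> I\<rbrakk> \<Longrightarrow>
      ((\<lambda>t. s t i) has_real_derivative - G (s t) i) (at t within {0..})"
    and subgradient: "\<And>u v. \<Phi> u + (\<Sum>i\<in>I. G u i * (v i - u i)) \<le> \<Phi> v"
    and energy: "\<And>t. 0 \<le> t \<Longrightarrow>
      ((\<lambda>t. \<Phi> (s t)) has_real_derivative - (\<Sum>i\<in>I. (G (s t) i)\<^sup>2)) (at t within {0..})"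
begin

definition speed2 :: "real \<Rightarrow> real" where
  "speed2 t = (\<Sum>i\<in>I. (G (s t) i)\<^sup>2)"

lemma G_monotone: "0 \<le> (\<Sum>i\<in>I. (G v i - G u i) * (v i - u i))"
proof -
  have "(\<Sum>i\<in>I. (G v i - G u i) * (v i - u i)) =
      - (\<Sum>i\<in>I. G u i * (v i - u i)) - (\<Sum>i\<in>I. G v i * (u i - v i))"
    by (simp add: algebra_simps sum.distrib sum_subtractf)
  with subgradient[of u v] subgradient[of v u] show ?thesis by linarith
qed

text \<open>The time-shifted curve solves the same flow, and monotonicity of \<open>G\<close> keeps
  two solutions from moving apart.\<close>

lemma contraction:
  assumes "0 \<le> h" "0 \<le> a" "a \<le> b"
  shows "(\<Sum>i\<in>I. (s (b + h) i - s b i)\<^sup>2) \<le> (\<Sum>i\<in>I. (s (a + h) i - s a i)\<^sup>2)"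
proof (rule nonincreasing_on_halfline[where f = "\<lambda>t. \<Sum>i\<in>I. (s (t + h) i - s t i)\<^sup>2"
      and f' = "\<lambda>t. - 2 * (\<Sum>i\<in>I. (G (s (t + h)) i - G (s t) i) * (s (t + h) i - s t i))", OF _ _ assms(2,3)])
  fix t :: real assume t: "0 \<le> t"
  have "((\<lambda>t. \<Sum>i\<in>I. (s (t + h) i - s t i)\<^sup>2) has_real_derivative
      (\<Sum>i\<in>I. 2 * (s (t + h) i - s t i) * (- G (s (t + h)) i - - G (s t) i))) (at t within {0..})"
    using t assms(1)
    by (intro DERIV_sum) (auto intro!: derivative_eq_intros DERIV_shift_halfline flow)
  then show "((\<lambda>t. \<Sum>i\<in>I. (s (t + h) i - s t i)\<^sup>2) has_real_derivative
      - 2 * (\<Sum>i\<in>I. (G (s (t + h)) i - G (s t) i) * (s (t + h) i - s t i))) (at t within {0..})"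
    by (simp add: sum_distrib_left algebra_simps)
  show "- 2 * (\<Sum>i\<in>I. (G (s (t + h)) i - G (s t) i) * (s (t + h) i - s t i)) \<le> 0"
    using G_monotone[of "s (t + h)" "s t"] by simp
qed

lemma quotient_tendsto:
  assumes "0 \<le> t" "i \<in> I"
  shows "((\<lambda>h. (s (t + h) i - s t i) / h) \<longlongrightarrow> - G (s t) i) (at_right 0)"
proof -
  have "((\<lambda>y. (s y i - s t i) / (y - t)) \<longlongrightarrow> - G (s t) i) (at_right t)"
    by (rule tendsto_mono[OF at_le flow[OF assms, unfolded has_field_derivative_iff]])
      (use assms in auto)
  then show ?thesis
    by (subst (asm) at_right_to_0) (simp add: filterlim_filtermap add.commute)
qed

text \<open>\<open>G\<close> is not assumed differentiable, so the speed cannot be differentiated in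
  time. Instead the contraction estimate is divided by the square of \<open>h\<close> and
  \<open>h\<close> tends to 0.\<close>

lemma speed2_antimono:
  assumes "0 \<le> a" "a \<le> b"
  shows "speed2 b \<le> speed2 a"
proof -
  have lim: "((\<lambda>h. \<Sum>i\<in>I. ((s (t + h) i - s t i) / h)\<^sup>2) \<longlongrightarrow> speed2 t) (at_right 0)" if "0 \<le> t" for t
  proof -
    have "((\<lambda>h. \<Sum>i\<in>I. ((s (t + h) i - s t i) / h)\<^sup>2) \<longlongrightarrow> (\<Sum>i\<in>I. (- G (s t) i)\<^sup>2)) (at_right 0)"
      using that by (intro tendsto_sum tendsto_power quotient_tendsto)
    then show ?thesis by (simp add: speed2_def)
  qed
  have "\<forall>\<^sub>F h in at_right 0. (\<Sum>i\<in>I. ((s (b + h) i - s b i) / h)\<^sup>2) \<le> (\<Sum>i\<in>I. ((s (a + h) i - s a i) / h)\<^sup>2)"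
    using eventually_at_right_less[of "0::real"]
  proof eventually_elim
    case (elim h)
    then show ?case
      using contraction[of h a b] assms
      by (simp add: power_divide divide_right_mono flip: sum_divide_distrib)
  qed
  from tendsto_le[OF _ lim lim this] show ?thesis using assms by simp
qed

lemma speed2_nonneg: "0 \<le> speed2 t"
  by (simp add: speed2_def sum_nonneg)

text \<open>The speed never exceeds its value at \<open>t\<close>. Pairing the curve with its fixed
  total displacement \<open>v\<close> makes the estimate scalar, and Cauchy-Schwarz bounds the
  squared norm of \<open>v\<close> by \<open>L2_set v I * c * h\<close>.\<close>

lemma displacement_le:
  assumes "0 \<le> t" "0 \<le> h"
  shows "(\<Sum>i\<in>I. (s t i - s (t + h) i)\<^sup>2) \<le> h\<^sup>2 * speed2 t"
proof -
  have bound: "L2_set (\<lambda>i. s t i - s (t + h) i) I \<le> h * c" if c: "0 < c" "speed2 t \<le> c\<^sup>2" for c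
  proof -
    define v where "v i = s t i - s (t + h) i" for i
    have "(\<Sum>i\<in>I. - v i * s (h + t) i) - L2_set v I * c * h \<le>
        (\<Sum>i\<in>I. - v i * s (0 + t) i) - L2_set v I * c * 0"
    proof (rule nonincreasing_on_halfline[where
          f = "\<lambda>\<tau>. (\<Sum>i\<in>I. - v i * s (\<tau> + t) i) - L2_set v I * c * \<tau>"
          and f' = "\<lambda>\<tau>. (\<Sum>i\<in>I. v i * G (s (\<tau> + t)) i) - L2_set v I * c"])
      fix \<tau> :: real assume \<tau>: "0 \<le> \<tau>"
      have "((\<lambda>\<tau>. (\<Sum>i\<in>I. - v i * s (\<tau> + t) i) - L2_set v I * c * \<tau>) has_real_derivative
          (\<Sum>i\<in>I. - v i * - G (s (\<tau> + t)) i) - L2_set v I * c * 1) (at \<tau> within {0..})"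
        using \<tau> assms(1)
        by (intro DERIV_diff DERIV_sum DERIV_cmult DERIV_ident DERIV_shift_halfline flow) auto
      then show "((\<lambda>\<tau>. (\<Sum>i\<in>I. - v i * s (\<tau> + t) i) - L2_set v I * c * \<tau>) has_real_derivative
          (\<Sum>i\<in>I. v i * G (s (\<tau> + t)) i) - L2_set v I * c) (at \<tau> within {0..})"
        by simp
      have "(\<Sum>i\<in>I. (G (s (\<tau> + t)) i)\<^sup>2) \<le> c\<^sup>2"
        using speed2_antimono[of t "\<tau> + t"] \<tau> assms(1) c by (simp add: speed2_def)
      from sum_mult_le_of_sum_squares[OF this c(1), of v]
      show "(\<Sum>i\<in>I. v i * G (s (\<tau> + t)) i) - L2_set v I * c \<le> 0" by simp
    qed (use assms in auto)
    then have "(\<Sum>i\<in>I. (v i)\<^sup>2) \<le> L2_set v I * c * h"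
      by (simp add: v_def power2_eq_square algebra_simps sum.distrib sum_subtractf sum_negf
          flip: sum_distrib_left)
    then have "L2_set v I * L2_set v I \<le> L2_set v I * (h * c)"
      by (simp add: L2_set_def sum_nonneg mult.commute mult.left_commute)
    moreover have "0 \<le> h * c" using assms c by simp
    ultimately show ?thesis
      using L2_set_nonneg[of v I] unfolding v_def[abs_def, symmetric]
      by (cases "L2_set v I = 0") (auto simp: mult_le_cancel_left)
  qed
  have "L2_set (\<lambda>i. s t i - s (t + h) i) I \<le> h * sqrt (speed2 t)"
  proof (rule field_le_epsilon)
    fix e :: real assume e: "0 < e"
    \<comment> \<open>The speed may vanish, while \<open>bound\<close> asks for a positive
      \<open>c\<close>; after multiplication by \<open>h\<close> the excess costs at most
      \<open>e\<close>, also for \<open>h = 0\<close>.\<close>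
    define c where "c = sqrt (speed2 t) + e / (h + 1)"
    have pos: "0 < e / (h + 1)" using e assms by simp
    have "(sqrt (speed2 t))\<^sup>2 \<le> c\<^sup>2"
      unfolding c_def using pos speed2_nonneg by (intro power_mono) auto
    then have "L2_set (\<lambda>i. s t i - s (t + h) i) I \<le> h * c"
      using pos speed2_nonneg[of t] by (intro bound) (auto simp: c_def intro: add_nonneg_pos)
    also have "\<dots> = h * sqrt (speed2 t) + h / (h + 1) * e"
      by (simp add: c_def algebra_simps)
    also have "\<dots> \<le> h * sqrt (speed2 t) + 1 * e"
      using e assms by (intro add_left_mono mult_right_mono) auto
    finally show "L2_set (\<lambda>i. s t i - s (t + h) i) I \<le> h * sqrt (speed2 t) + e" by simp
  qed
  then have "(L2_set (\<lambda>i. s t i - s (t + h) i) I)\<^sup>2 \<le> (h * sqrt (speed2 t))\<^sup>2"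
    by (intro power_mono L2_set_nonneg)
  then show ?thesis
    by (simp add: L2_set_def sum_nonneg power_mult_distrib speed2_nonneg)
qed

lemma quotient_close:
  assumes t: "0 \<le> t" and h: "0 < h" and \<rho>: "\<And>t. 0 \<le> t \<Longrightarrow> \<rho> \<le> speed2 t" and i: "i \<in> I"
  shows "(G (s t) i - (s t i - s (t + h) i) / h)\<^sup>2 \<le> 2 * (speed2 t - \<rho>)"
proof -
  have "\<Phi> (s (h + t)) + \<rho> * h \<le> \<Phi> (s (0 + t)) + \<rho> * 0"
  proof (rule nonincreasing_on_halfline[where f = "\<lambda>\<tau>. \<Phi> (s (\<tau> + t)) + \<rho> * \<tau>"
        and f' = "\<lambda>\<tau>. - speed2 (\<tau> + t) + \<rho> * 1"])
    fix \<tau> :: real assume \<tau>: "0 \<le> \<tau>"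
    show "((\<lambda>\<tau>. \<Phi> (s (\<tau> + t)) + \<rho> * \<tau>) has_real_derivative - speed2 (\<tau> + t) + \<rho> * 1) (at \<tau> within {0..})"
      unfolding speed2_def using \<tau> t
      by (intro DERIV_add DERIV_cmult DERIV_ident DERIV_shift_halfline[of "\<lambda>t. \<Phi> (s t)"] energy) auto
    show "- speed2 (\<tau> + t) + \<rho> * 1 \<le> 0" using \<rho>[of "\<tau> + t"] \<tau> t by simp
  qed (use h in auto)
  then have "\<rho> * h \<le> (\<Sum>i\<in>I. G (s t) i * (s t i - s (t + h) i))"
    using subgradient[of "s t" "s (t + h)"]
    by (simp add: algebra_simps sum_subtractf)
  then have cross: "\<rho> \<le> (\<Sum>i\<in>I. G (s t) i * ((s t i - s (t + h) i) / h))"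
    using h by (simp add: field_simps flip: sum_divide_distrib)
  have sq: "(\<Sum>i\<in>I. ((s t i - s (t + h) i) / h)\<^sup>2) \<le> speed2 t"
    using displacement_le[OF t, of h] h
    by (simp add: power_divide field_simps flip: sum_divide_distrib)
  have "(G (s t) i - (s t i - s (t + h) i) / h)\<^sup>2 \<le> (\<Sum>i\<in>I. (G (s t) i - (s t i - s (t + h) i) / h)\<^sup>2)"
    using i finite_I by (intro member_le_sum) auto
  also have "\<dots> = speed2 t + (\<Sum>i\<in>I. ((s t i - s (t + h) i) / h)\<^sup>2)
      - 2 * (\<Sum>i\<in>I. G (s t) i * ((s t i - s (t + h) i) / h))"
    by (simp add: power2_diff sum.distrib sum_subtractf speed2_def sum_distrib_left mult.assoc)
  also have "\<dots> \<le> 2 * (speed2 t - \<rho>)" using cross sq by simp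
  finally show ?thesis .
qed

lemma velocity_converges:
  assumes i: "i \<in> I"
  obtains c where "((\<lambda>t. G (s t) i) \<longlongrightarrow> c) at_top"
proof -
  define \<rho> where "\<rho> = Inf (speed2 ` {0..})"
  have \<rho>: "\<rho> \<le> speed2 t" if "0 \<le> t" for t
    unfolding \<rho>_def using that speed2_nonneg by (intro cInf_lower bdd_belowI[of _ 0]) auto
  define \<epsilon> where "\<epsilon> t = sqrt (2 * (speed2 t - \<rho>))" for t
  have close: "\<bar>G (s t) i - (s t i - s (t + h) i) / h\<bar> \<le> \<epsilon> t" if "0 \<le> t" "0 < h" for t h
    unfolding \<epsilon>_def using quotient_close[OF that \<rho> i] by (simp add: real_le_rsqrt)
  have cauchy: "\<bar>G (s a) i - G (s b) i\<bar> \<le> \<epsilon> a + \<epsilon> b" if ab: "0 \<le> a" "0 \<le> b" for a b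
  proof -
    let ?q = "\<lambda>t T. (s t i - s T i) / (T - t)"
    \<comment> \<open>Both quotients end at the same time \<open>T\<close>. Over the denominator
      \<open>T - a\<close> their difference has a numerator bounded by \<open>C\<close> uniformly in
      \<open>T\<close>, because \<open>?q b T\<close> stays within \<open>\<epsilon> b\<close> of
      \<open>G (s b) i\<close>.\<close>
    define C where "C = (\<bar>G (s b) i\<bar> + \<epsilon> b) * \<bar>b - a\<bar> + \<bar>s a i - s b i\<bar>"
    have "\<bar>G (s a) i - G (s b) i\<bar> - (\<epsilon> a + \<epsilon> b) \<le> C / (T - a)" if T: "T > a" "T > b" for T
    proof -
      have ca: "\<bar>G (s a) i - ?q a T\<bar> \<le> \<epsilon> a" and cb: "\<bar>G (s b) i - ?q b T\<bar> \<le> \<epsilon> b"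
        using close[of a "T - a"] close[of b "T - b"] T ab by auto
      have "?q a T - ?q b T = (s a i - s b i + ?q b T * (a - b)) / (T - a)"
        using T by (simp add: field_simps)
      moreover have "\<bar>s a i - s b i + ?q b T * (a - b)\<bar> \<le> C"
      proof -
        have "\<bar>?q b T * (a - b)\<bar> \<le> (\<bar>G (s b) i\<bar> + \<epsilon> b) * \<bar>b - a\<bar>"
          unfolding abs_mult[of "?q b T"] using cb by (intro mult_mono; linarith)
        then show ?thesis unfolding C_def by linarith
      qed
      ultimately have "\<bar>?q a T - ?q b T\<bar> \<le> C / (T - a)"
        using T by (simp add: abs_divide divide_right_mono)
      with ca cb show ?thesis by linarith
    qed
    then have "\<forall>\<^sub>F T in at_top. \<bar>G (s a) i - G (s b) i\<bar> - (\<epsilon> a + \<epsilon> b) \<le> C / (T - a)"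
      by (intro eventually_mono[OF eventually_gt_at_top[of "max a b"]]) simp
    moreover have "((\<lambda>T. C / (T - a)) \<longlongrightarrow> 0) at_top"
      using filterlim_tendsto_add_at_top[OF tendsto_const[of "- a"] filterlim_ident[of at_top]]
      by (intro tendsto_divide_0[OF tendsto_const] filterlim_at_top_imp_at_infinity) simp
    ultimately have "\<bar>G (s a) i - G (s b) i\<bar> - (\<epsilon> a + \<epsilon> b) \<le> 0"
      by (intro tendsto_lowerbound[of _ 0 at_top]) auto
    then show ?thesis by simp
  qed
  have small: "\<exists>T\<ge>0. \<forall>t\<ge>T. \<epsilon> t < e" if "0 < e" for e
  proof -
    \<comment> \<open>The half compensates the factor 2 under the square root in \<epsilon>.\<close>
    have "\<rho> < \<rho> + e\<^sup>2 / 2" using that by simp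
    then obtain T where T: "0 \<le> T" "speed2 T < \<rho> + e\<^sup>2 / 2"
      unfolding \<rho>_def by (subst (asm) cInf_less_iff) (auto intro: bdd_belowI[of _ 0] speed2_nonneg)
    have "\<epsilon> t < e" if "T \<le> t" for t
    proof -
      have "2 * (speed2 t - \<rho>) < e\<^sup>2"
        using speed2_antimono[OF T(1) that] T(2) by simp
      then show ?thesis unfolding \<epsilon>_def using \<open>0 < e\<close> by (intro real_less_lsqrt) auto
    qed
    with T(1) show ?thesis by blast
  qed
  have "cauchy_filter (filtermap (\<lambda>t. G (s t) i) at_top)"
    unfolding cauchy_filter_metric_filtermap
  proof (intro allI impI)
    fix e :: real assume "0 < e"
    with small[of "e / 2"] obtain T where T: "T \<ge> 0" "\<And>t. T \<le> t \<Longrightarrow> \<epsilon> t < e / 2" by auto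
    have "dist (G (s a) i) (G (s b) i) < e" if "T \<le> a" "T \<le> b" for a b
      using cauchy[of a b] T(1) T(2)[OF that(1)] T(2)[OF that(2)] that by (simp add: dist_real_def)
    then show "\<exists>P. eventually P at_top \<and> (\<forall>a b. P a \<and> P b \<longrightarrow> dist (G (s a) i) (G (s b) i) < e)"
      by (intro exI[of _ "\<lambda>t. T \<le> t"]) (auto simp: eventually_ge_at_top)
  qed
  from cauchy_filter_complete_converges[OF this complete_UNIV]
  obtain c where "filtermap (\<lambda>t. G (s t) i) at_top \<le> nhds c"
    by (auto simp: filtermap_bot_iff)
  then show thesis using that by (simp add: filterlim_def)
qed

end

text \<open>Jensen's inequality for \<open>exp\<close> with the Gibbs weights
  \<open>exp (- u i) / Z\<close>: the weighted mean of \<open>exp (u i - v i)\<close> is the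
  quotient of the two partition sums.\<close>

lemma ln_sum_exp_subgradient:
  fixes u v :: "'i \<Rightarrow> real"
  assumes "finite A"
  defines "Z \<equiv> \<Sum>i\<in>A. exp (- u i)"
  shows "ln Z + (\<Sum>i\<in>A. - (exp (- u i) / Z) * (v i - u i)) \<le> ln (\<Sum>i\<in>A. exp (- v i))"
proof (cases "A = {}")
  case False
  define p where "p i = exp (- u i) / Z" for i
  have Z: "Z > 0" unfolding Z_def using assms False by (intro sum_pos) auto
  have "exp (\<Sum>i\<in>A. p i *\<^sub>R (u i - v i)) \<le> (\<Sum>i\<in>A. p i * exp (u i - v i))"
    using Z assms False
    by (intro convex_on_sum[where C = UNIV] exp_convex)
      (auto simp: p_def less_imp_le simp flip: sum_divide_distrib)
  also have "\<dots> = (\<Sum>i\<in>A. exp (- v i)) / Z"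
    by (simp add: p_def sum_divide_distrib exp_diff exp_minus field_simps)
  finally have "(\<Sum>i\<in>A. p i * (u i - v i)) \<le> ln ((\<Sum>i\<in>A. exp (- v i)) / Z)"
    using Z assms False by (subst ln_ge_iff) (auto intro!: divide_pos_pos sum_pos)
  also have "\<dots> = ln (\<Sum>i\<in>A. exp (- v i)) - ln Z"
    using Z assms(1) False by (intro ln_divide_pos) (auto intro!: sum_pos)
  finally show ?thesis
    by (simp add: p_def right_diff_distrib sum_subtractf sum_negf)
qed (simp add: Z_def)

subsection \<open>The flow in logarithmic coordinates\<close>

text \<open>Double counting of incidences; it turns edge sums of curvatures into vertex sums
  matching the potential.\<close>

lemma sum_edges_endpoints:
  assumes "simple_graph V E" "finite V"
  shows "(\<Sum>e\<in>E. \<Sum>x\<in>e. h x e) = (\<Sum>x\<in>V. \<Sum>e\<in>incident E x. h x e)"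
proof -
  have "{x. x \<in> V \<and> x \<in> e} = e" if "e \<in> E" for e
    using assms that by (fastforce simp: simple_graph_def)
  then have "(\<Sum>e\<in>E. \<Sum>x\<in>e. h x e) = (\<Sum>e\<in>E. \<Sum>x | x \<in> V \<and> x \<in> e. h x e)"
    by simp
  also have "\<dots> = (\<Sum>x\<in>V. \<Sum>e | e \<in> E \<and> x \<in> e. h x e)"
    using finite_edges[OF assms] assms by (intro sum.swap_restrict)
  finally show ?thesis by (simp add: incident_def)
qed

lemma face_curvature_all_edges:
  "face_curvature E E p e = (\<Sum>x\<in>e. (2 - real (degree E x)) / (p e * weighted_degree E p x))"
proof -
  have "{x \<in> e. incident E x \<subseteq> E} = e" by (auto simp: incident_def)
  then show ?thesis by (simp add: face_curvature_def weighted_degree_def)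
qed

text \<open>The weight and the sum of reciprocals scale inversely, so their product is unchanged.
  Hence the rescaled flow has the curvatures of the original one.\<close>

lemma face_curvature_scale:
  assumes "\<And>f. f \<in> E \<Longrightarrow> q f = c * p f" "c \<noteq> 0" "e \<in> E"
  shows "face_curvature E C q e = face_curvature E C p e"
proof -
  have "q e * (\<Sum>f\<in>incident E x. 1 / q f) = p e * (\<Sum>f\<in>incident E x. 1 / p f)" for x
  proof -
    have "q e * (\<Sum>f\<in>incident E x. 1 / q f) = c * p e * (\<Sum>f\<in>incident E x. 1 / (c * p f))"
      using assms by (simp add: incident_def)
    also have "\<dots> = p e * (\<Sum>f\<in>incident E x. 1 / p f)"
      using \<open>c \<noteq> 0\<close> by (simp add: sum_distrib_left)
    finally show ?thesis .
  qed
  then show ?thesis by (simp add: face_curvature_def)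
qed

text \<open>The edge's own reciprocal weight is a summand of the weighted degree, so every
  denominator is at least 1. The bound is uniform over positive metrics, which is what preserves
  positivity.\<close>

lemma abs_face_curvature_le:
  assumes "simple_graph V E" "finite V" "positive_metric E p" "e \<in> E"
  shows "\<bar>face_curvature E E p e\<bar> \<le> (\<Sum>x\<in>V. \<bar>2 - real (degree E x)\<bar>)"
proof -
  have eV: "e \<subseteq> V" using assms by (fastforce simp: simple_graph_def)
  have fin: "finite E" by (rule finite_edges[OF assms(1,2)])
  have quot: "\<bar>a / p\<bar> \<le> \<bar>a\<bar>" if "1 \<le> p" for a p :: real
    using mult_left_mono[OF that, of "\<bar>a\<bar>"] that by (simp add: pos_divide_le_eq)
  have "\<bar>(2 - real (degree E x)) / (p e * weighted_degree E p x)\<bar> \<le> \<bar>2 - real (degree E x)\<bar>"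
    if x: "x \<in> e" for x
  proof -
    have "1 / p e \<le> weighted_degree E p x"
      unfolding weighted_degree_def
      by (rule member_le_sum) (use assms x fin in \<open>auto simp: incident_def positive_metric_def less_imp_le\<close>)
    then have "1 \<le> p e * weighted_degree E p x"
      using assms by (simp add: positive_metric_def field_simps)
    then show ?thesis by (rule quot)
  qed
  then have "\<bar>face_curvature E E p e\<bar> \<le> (\<Sum>x\<in>e. \<bar>2 - real (degree E x)\<bar>)"
    unfolding face_curvature_all_edges by (intro order_trans[OF sum_abs] sum_mono)
  also have "\<dots> \<le> (\<Sum>x\<in>V. \<bar>2 - real (degree E x)\<bar>)"
    using eV assms by (intro sum_mono2) auto
  finally show ?thesis .
qed

definition tree_potential :: "'a set \<Rightarrow> 'a set set \<Rightarrow> ('a set \<Rightarrow> real) \<Rightarrow> real" where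
  "tree_potential V E u = (\<Sum>x\<in>V. (real (degree E x) - 2) * ln (\<Sum>f\<in>incident E x. exp (- u f)))"

text \<open>In this form the curvature is visibly the gradient of \<open>tree_potential\<close>: the
  negated quotient is the partial derivative of the log-sum-exp at \<open>x\<close>.\<close>

lemma face_curvature_exp:
  "face_curvature E E (\<lambda>f. exp (u f)) e =
    (\<Sum>x\<in>e. (real (degree E x) - 2) * - (exp (- u e) / (\<Sum>f\<in>incident E x. exp (- u f))))"
proof -
  have "(2 - d) / (exp a * Z) = (d - 2) * - (exp (- a) / Z)" for d a Z :: real
    by (cases "Z = 0") (simp_all add: exp_minus field_simps)
  then show ?thesis
    unfolding face_curvature_all_edges weighted_degree_def
    by (simp add: exp_minus inverse_eq_divide)
qed

text \<open>
  The terms of the leaves, whose coefficient is \<open>-1\<close>, are linear, so they do not spoil convexity.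
\<close>

lemma tree_potential_subgradient:
  assumes "simple_graph V E" "finite V"
  shows "tree_potential V E u + (\<Sum>e\<in>E. face_curvature E E (\<lambda>f. exp (u f)) e * (v e - u e))
    \<le> tree_potential V E v"
proof -
  let ?Z = "\<lambda>u x. \<Sum>f\<in>incident E x. exp (- u f)"
  let ?c = "\<lambda>x. real (degree E x) - 2"
  have fin: "finite (incident E x)" for x
    using finite_edges[OF assms] by (simp add: incident_def)
  have "(\<Sum>e\<in>E. face_curvature E E (\<lambda>f. exp (u f)) e * (v e - u e)) =
      (\<Sum>e\<in>E. \<Sum>x\<in>e. ?c x * (- (exp (- u e) / ?Z u x) * (v e - u e)))"
    unfolding face_curvature_exp by (simp add: sum_distrib_right mult.assoc)
  also have "\<dots> = (\<Sum>x\<in>V. ?c x * (\<Sum>e\<in>incident E x. - (exp (- u e) / ?Z u x) * (v e - u e)))"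
    by (subst sum_edges_endpoints[OF assms]) (simp add: sum_distrib_left)
  finally have "tree_potential V E u + (\<Sum>e\<in>E. face_curvature E E (\<lambda>f. exp (u f)) e * (v e - u e)) =
      (\<Sum>x\<in>V. ?c x * (ln (?Z u x) + (\<Sum>e\<in>incident E x. - (exp (- u e) / ?Z u x) * (v e - u e))))"
    by (simp add: tree_potential_def distrib_left sum.distrib)
  also have "\<dots> \<le> tree_potential V E v"
    unfolding tree_potential_def
  proof (rule sum_mono)
    fix x
    have "degree E x \<noteq> 0 \<or> incident E x = {}" using fin[of x] by (simp add: degree_def)
    then consider "incident E x = {}" | "degree E x = 1" | "2 \<le> degree E x" by linarith
    then show "?c x * (ln (?Z u x) + (\<Sum>e\<in>incident E x. - (exp (- u e) / ?Z u x) * (v e - u e)))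
        \<le> ?c x * ln (?Z v x)"
    proof cases
      case 2
      then obtain f where "incident E x = {f}" by (auto simp: degree_def card_1_singleton_iff)
      then show ?thesis by simp
    next
      case 3
      then show ?thesis
        using ln_sum_exp_subgradient[OF fin, where u = u and v = v] by (intro mult_left_mono) auto
    qed simp
  qed
  finally show ?thesis .
qed

text \<open>Chain rule along a curve with velocity \<open>- g\<close>; taking the curvature itself
  for \<open>g\<close> gives the energy identity.\<close>

lemma tree_potential_has_derivative:
  assumes "simple_graph V E" "finite V"
    and s: "\<And>e. e \<in> E \<Longrightarrow> ((\<lambda>t. s t e) has_real_derivative - g e) (at t within S)"
  shows "((\<lambda>t. tree_potential V E (s t)) has_real_derivative
    - (\<Sum>e\<in>E. face_curvature E E (\<lambda>f. exp (s t f)) e * g e)) (at t within S)"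
proof -
  let ?Z = "\<lambda>t x. \<Sum>f\<in>incident E x. exp (- s t f)"
  let ?c = "\<lambda>x. real (degree E x) - 2"
  have fin: "finite (incident E x)" for x
    using finite_edges[OF assms(1,2)] by (simp add: incident_def)
  have "((\<lambda>t. ln (?Z t x)) has_real_derivative (\<Sum>e\<in>incident E x. exp (- s t e) * g e) / ?Z t x)
      (at t within S)" for x
  proof (cases "incident E x = {}")
    case False
    have "?Z t x > 0" using False fin by (intro sum_pos) auto
    moreover have "((\<lambda>t. ?Z t x) has_real_derivative (\<Sum>e\<in>incident E x. exp (- s t e) * g e)) (at t within S)"
      by (intro DERIV_sum) (auto simp: incident_def intro!: derivative_eq_intros s)
    ultimately show ?thesis
      using DERIV_chain2[OF DERIV_ln_divide] by fastforce
  qed simp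
  then have "((\<lambda>t. tree_potential V E (s t)) has_real_derivative
      (\<Sum>x\<in>V. ?c x * ((\<Sum>e\<in>incident E x. exp (- s t e) * g e) / ?Z t x))) (at t within S)"
    unfolding tree_potential_def by (intro DERIV_sum DERIV_cmult)
  also have "(\<Sum>x\<in>V. ?c x * ((\<Sum>e\<in>incident E x. exp (- s t e) * g e) / ?Z t x)) =
      (\<Sum>e\<in>E. \<Sum>x\<in>e. ?c x * (exp (- s t e) / ?Z t x * g e))"
    by (subst sum_edges_endpoints[OF assms(1,2)]) (simp add: sum_distrib_left sum_divide_distrib)
  also have "\<dots> = - (\<Sum>e\<in>E. face_curvature E E (\<lambda>f. exp (s t f)) e * g e)"
    unfolding face_curvature_exp by (simp add: sum_distrib_right mult.assoc sum_negf)
  finally show ?thesis .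
qed

section \<open>Positivity, total mass and rescaling along the flow\<close>

locale tree_flow =
  fixes V :: "'a set" and E :: "'a set set" and w :: "real \<Rightarrow> 'a set \<Rightarrow> real"
  assumes tree: "finite_tree V E" and edges: "E \<noteq> {}" and nflow: "normalized_flow V E w"
begin

lemma finite_V: "finite V" and simple: "simple_graph V E"
  using tree by (auto simp: finite_tree_def)

lemma finite_E: "finite E"
  by (rule finite_edges[OF simple finite_V])

lemma flow_derivative:
  assumes "0 \<le> t" "e \<in> E"
  shows "((\<lambda>s. w s e) has_real_derivative
    - w t e * (curvature V E (w t) e - mean_curvature V E (w t))) (at t within {0..})"
  using nflow assms by (auto simp: normalized_flow_def)

lemma continuous_flow: "e \<in> E \<Longrightarrow> continuous_on {0..} (\<lambda>t. w t e)"
  using flow_derivative by (auto simp: continuous_on_eq_continuous_within intro: DERIV_continuous)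

text \<open>Gronwall argument up to the first time \<open>T\<close> at which some weight is
  nonpositive: before \<open>T\<close> the curvature formula and its uniform bound apply, so a
  weight decays at most exponentially and cannot reach 0 at \<open>T\<close>.\<close>

lemma positive_flow:
  assumes "0 \<le> t"
  shows "positive_metric E (w t)"
proof (rule ccontr)
  assume "\<not> positive_metric E (w t)"
  then obtain e\<^sub>0 where e\<^sub>0: "e\<^sub>0 \<in> E" "w t e\<^sub>0 \<le> 0" by (auto simp: positive_metric_def not_less)
  define N where "N = (\<Union>e\<in>E. {t \<in> {0..}. w t e \<le> 0})"
  have bdd: "bdd_below N" by (rule bdd_belowI[of _ 0]) (auto simp: N_def)
  have "closed N" unfolding N_def
    by (intro closed_UN finite_E ballI continuous_on_closed_Collect_le continuous_flow) auto
  define T where "T = Inf N"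
  have "T \<in> N"
    unfolding T_def by (rule closed_contains_Inf) (use \<open>closed N\<close> bdd e\<^sub>0 assms in \<open>auto simp: N_def\<close>)
  then obtain e where e: "e \<in> E" "w T e \<le> 0" "0 \<le> T" by (auto simp: N_def)
  have pos: "positive_metric E (w \<tau>)" if "0 \<le> \<tau>" "\<tau> < T" for \<tau>
  proof -
    have "\<tau> \<notin> N" using that cInf_lower[OF _ bdd, of \<tau>] by (auto simp: T_def)
    then show ?thesis using that by (auto simp: N_def positive_metric_def not_le)
  qed
  \<comment> \<open>Conservation of mass will rest on positivity, so here the mass is merely bounded
    by compactness of \<open>{0..T}\<close>.\<close>
  have "continuous_on {0..T} (\<lambda>\<tau>. \<Sum>f\<in>E. w \<tau> f)"
    by (intro continuous_on_sum continuous_on_subset[OF continuous_flow]) auto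
  from continuous_attains_sup[OF compact_Icc _ this] \<open>0 \<le> T\<close>
  obtain S where S: "\<And>\<tau>. \<lbrakk>0 \<le> \<tau>; \<tau> \<le> T\<rbrakk> \<Longrightarrow> (\<Sum>f\<in>E. w \<tau> f) \<le> S" by force
  define M where "M = (\<Sum>x\<in>V. \<bar>2 - real (degree E x)\<bar>)"
  have M: "\<bar>curvature V E (w \<tau>) f\<bar> \<le> M" if "0 \<le> \<tau>" "\<tau> < T" "f \<in> E" for \<tau> f
    using abs_face_curvature_le[OF simple finite_V pos[OF that(1,2)] that(3)]
      curvature_tree[OF tree pos[OF that(1,2)] that(3)] by (simp add: M_def)
  have "0 \<le> M" by (simp add: M_def sum_nonneg)
  have K: "- (M * S) \<le> mean_curvature V E (w \<tau>)" if \<tau>: "0 \<le> \<tau>" "\<tau> < T" for \<tau>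
  proof -
    have "- (M * S) \<le> - M * (\<Sum>f\<in>E. w \<tau> f)"
      using S[of \<tau>] \<tau> \<open>0 \<le> M\<close> by (simp add: mult_left_mono)
    also have "\<dots> = (\<Sum>f\<in>E. w \<tau> f * - M)"
      by (simp add: sum_distrib_left sum_negf mult.commute)
    also have "\<dots> \<le> (\<Sum>f\<in>E. w \<tau> f * curvature V E (w \<tau>) f)"
    proof (intro sum_mono mult_left_mono)
      fix f assume f: "f \<in> E"
      show "- M \<le> curvature V E (w \<tau>) f" using M[OF \<tau> f] by linarith
      show "0 \<le> w \<tau> f" using pos[OF \<tau>] f by (auto simp: positive_metric_def less_imp_le)
    qed
    finally show ?thesis by (simp add: mean_curvature_def)
  qed
  \<comment> \<open>\<open>M\<close> bounds the curvature from above and \<open>- (M * S)\<close>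
    the mean curvature from below, so \<open>B\<close> bounds the decay rate.\<close>
  define B where "B = M + M * S"
  have "w 0 e * exp (B * 0) \<le> w T e * exp (B * T)"
  proof (rule DERIV_nonneg_imp_increasing_open[OF \<open>0 \<le> T\<close>])
    fix \<tau> assume \<tau>: "0 < \<tau>" "\<tau> < T"
    let ?k = "curvature V E (w \<tau>) e - mean_curvature V E (w \<tau>)"
    have "at \<tau> within {0..} = at \<tau>"
      using \<tau> by (intro at_within_interior) (auto simp: interior_Ici[of _ "- 1"])
    with flow_derivative[of \<tau> e] \<tau> e have "((\<lambda>s. w s e) has_real_derivative - w \<tau> e * ?k) (at \<tau>)"
      by simp
    then have "((\<lambda>\<tau>. w \<tau> e * exp (B * \<tau>)) has_real_derivative
        w \<tau> e * (B - ?k) * exp (B * \<tau>)) (at \<tau>)"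
      by (auto intro!: derivative_eq_intros simp: algebra_simps)
    moreover have "0 \<le> w \<tau> e * (B - ?k) * exp (B * \<tau>)"
    proof (intro mult_nonneg_nonneg)
      show "0 \<le> w \<tau> e" using pos[of \<tau>] \<tau> e by (auto simp: positive_metric_def less_imp_le)
      show "0 \<le> B - ?k" using M[of \<tau> e] K[of \<tau>] \<tau> e unfolding B_def by linarith
    qed auto
    ultimately show "\<exists>y. ((\<lambda>\<tau>. w \<tau> e * exp (B * \<tau>)) has_real_derivative y) (at \<tau>) \<and> 0 \<le> y" by blast
  next
    show "continuous_on {0..T} (\<lambda>\<tau>. w \<tau> e * exp (B * \<tau>))"
      by (intro continuous_intros continuous_on_subset[OF continuous_flow]) (use e in auto)
  qed
  moreover have "0 < w 0 e" using nflow e by (auto simp: normalized_flow_def positive_metric_def)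
  ultimately have "0 < w T e * exp (B * T)" by simp
  then show False using e(2) by (simp add: zero_less_mult_iff)
qed

lemma flow_pos: "\<lbrakk>0 \<le> t; e \<in> E\<rbrakk> \<Longrightarrow> 0 < w t e"
  using positive_flow by (auto simp: positive_metric_def)

lemma curvature_flow:
  "\<lbrakk>0 \<le> t; e \<in> E\<rbrakk> \<Longrightarrow> curvature V E (w t) e = face_curvature E E (w t) e"
  by (rule curvature_tree[OF tree positive_flow])

lemma continuous_curvature:
  assumes e: "e \<in> E"
  shows "continuous_on {0..} (\<lambda>t. curvature V E (w t) e)"
proof -
  have "continuous_on {0..} (\<lambda>t. face_curvature E E (w t) e)"
    unfolding face_curvature_all_edges
  proof (intro continuous_on_sum continuous_on_divide continuous_on_mult continuous_on_const
      continuous_flow[OF e] ballI)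
    fix x t assume x: "x \<in> e" and t: "t \<in> {0::real..}"
    show "w t e * weighted_degree E (w t) x \<noteq> 0"
      using flow_pos[of t e] weighted_degree_pos[OF finite_E positive_flow e x, of t] t e by simp
  next
    fix x
    show "continuous_on {0..} (\<lambda>t. weighted_degree E (w t) x)"
      unfolding weighted_degree_def
      by (intro continuous_on_sum continuous_on_divide continuous_on_const continuous_flow)
        (auto simp: incident_def dest!: flow_pos)
  qed
  then show ?thesis by (rule continuous_on_eq) (simp add: curvature_flow e)
qed

text \<open>Logarithm of the common factor turning the normalized flow into the unnormalized one;
  its exponential is also the integrating factor of the mass equation.\<close>

definition log_scale :: "real \<Rightarrow> real" where
  "log_scale t = - integral {0..t} (\<lambda>t. mean_curvature V E (w t))"

lemma log_scale_derivative:
  assumes "0 \<le> t"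
  shows "(log_scale has_real_derivative - mean_curvature V E (w t)) (at t within {0..})"
proof -
  \<comment> \<open>The extra unit makes the compact interval agree with \<open>{0..}\<close> near
    \<open>t\<close>, so that the two derivatives coincide.\<close>
  have "continuous_on {0..t + 1} (\<lambda>t. mean_curvature V E (w t))"
    unfolding mean_curvature_def
    by (intro continuous_on_sum continuous_on_mult continuous_on_subset[OF continuous_flow]
        continuous_on_subset[OF continuous_curvature]) auto
  then have "((\<lambda>t. integral {0..t} (\<lambda>t. mean_curvature V E (w t))) has_real_derivative
      mean_curvature V E (w t)) (at t within {0..t + 1})"
    by (rule integral_has_real_derivative) (use assms in auto)
  moreover have "at t within {0..t + 1} = at t within {0..}"
    by (rule at_within_nhd[of t "{..<t + 1}"]) auto
  ultimately show ?thesis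
    unfolding log_scale_def[abs_def] by (auto intro: DERIV_minus)
qed

text \<open>The mass satisfies the linear equation \<open>y' = (y - 1) K\<close>, so
  \<open>y - 1\<close> times the integrating factor is constant and stays 0.\<close>

lemma sum_flow:
  assumes "0 \<le> t"
  shows "(\<Sum>e\<in>E. w t e) = 1"
proof -
  define y where "y t = (\<Sum>e\<in>E. w t e)" for t
  define P where "P t = (y t - 1) * exp (log_scale t)" for t
  have "(P has_real_derivative 0) (at t within {0..})" if t: "t \<in> {0..}" for t
  proof -
    let ?K = "mean_curvature V E (w t)"
    have "(y has_real_derivative
        (\<Sum>e\<in>E. - w t e * (curvature V E (w t) e - ?K))) (at t within {0..})"
      unfolding y_def[abs_def] using t by (intro DERIV_sum flow_derivative) auto
    also have "(\<Sum>e\<in>E. - w t e * (curvature V E (w t) e - ?K)) =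
        - (\<Sum>e\<in>E. w t e * curvature V E (w t) e) + (\<Sum>e\<in>E. w t e) * ?K"
      by (simp add: right_diff_distrib sum_subtractf sum_negf sum_distrib_right)
    also have "\<dots> = (y t - 1) * ?K"
      by (simp add: mean_curvature_def y_def algebra_simps)
    finally show ?thesis
      unfolding P_def using log_scale_derivative[of t] t
      by (auto intro!: derivative_eq_intros)
  qed
  from has_field_derivative_zero_constant[OF convex_real_interval(1) this]
  obtain c where "\<And>t. 0 \<le> t \<Longrightarrow> P t = c" by auto
  then have "P t = P 0" using assms by simp
  moreover have "P 0 = 0" using nflow by (simp add: P_def y_def normalized_flow_def)
  ultimately show ?thesis by (simp add: P_def y_def)
qed

definition log_flow :: "real \<Rightarrow> 'a set \<Rightarrow> real" where
  "log_flow t e = ln (w t e) + log_scale t"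

lemma face_curvature_log_flow:
  assumes "0 \<le> t" "e \<in> E"
  shows "face_curvature E E (\<lambda>f. exp (log_flow t f)) e = curvature V E (w t) e"
  unfolding curvature_flow[OF assms]
  by (rule face_curvature_scale[where c = "exp (log_scale t)"])
    (use assms flow_pos in \<open>auto simp: log_flow_def exp_add mult.commute\<close>)

lemma log_flow_derivative:
  assumes "0 \<le> t" "e \<in> E"
  shows "((\<lambda>t. log_flow t e) has_real_derivative - curvature V E (w t) e) (at t within {0..})"
  unfolding log_flow_def using flow_pos[OF assms]
  by (auto intro!: derivative_eq_intros flow_derivative[OF assms] log_scale_derivative[OF assms(1)])

sublocale log_flow: convex_gradient_flow E "tree_potential V E"
  "\<lambda>u. face_curvature E E (\<lambda>f. exp (u f))" log_flow
proof
  show "((\<lambda>t. tree_potential V E (log_flow t)) has_real_derivative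
      - (\<Sum>e\<in>E. (face_curvature E E (\<lambda>f. exp (log_flow t f)) e)\<^sup>2)) (at t within {0..})"
    if "0 \<le> t" for t
    unfolding power2_eq_square
    by (rule tree_potential_has_derivative[OF simple finite_V])
      (simp add: that face_curvature_log_flow log_flow_derivative)
qed (simp_all add: finite_E face_curvature_log_flow log_flow_derivative
    tree_potential_subgradient[OF simple finite_V])

lemma curvature_tendsto:
  assumes e: "e \<in> E"
  shows "((\<lambda>t. curvature V E (w t) e) \<longlongrightarrow> limit_curvature V E w e) at_top"
proof -
  obtain c where "((\<lambda>t. face_curvature E E (\<lambda>f. exp (log_flow t f)) e) \<longlongrightarrow> c) at_top"
    using log_flow.velocity_converges[OF e] by blast
  then have "((\<lambda>t. curvature V E (w t) e) \<longlongrightarrow> c) at_top"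
    by (rule Lim_transform_eventually)
      (use e in \<open>auto simp: face_curvature_log_flow intro!: eventually_mono[OF eventually_ge_at_top[of 0]]\<close>)
  moreover from this have "limit_curvature V E w e = c"
    unfolding limit_curvature_def by (intro tendsto_Lim) simp_all
  ultimately show ?thesis by simp
qed

end

subsection \<open>Omega-limit points\<close>

text \<open>Bolzano-Weierstrass one coordinate at a time, each refining the subsequence chosen so
  far.\<close>

lemma finite_family_convergent_subsequence:
  fixes X :: "nat \<Rightarrow> 'i \<Rightarrow> real"
  assumes "finite A" "\<And>n a. a \<in> A \<Longrightarrow> X n a \<in> {l..u}"
  obtains r L where "strict_mono r" "\<And>a. a \<in> A \<Longrightarrow> (\<lambda>n. X (r n) a) \<longlonglongrightarrow> L a"
proof -
  have "\<exists>r L. strict_mono r \<and> (\<forall>a\<in>A. (\<lambda>n. X (r n) a) \<longlonglongrightarrow> L a)"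
    using assms
  proof (induction A)
    case empty
    show ?case using strict_mono_id by blast
  next
    case (insert a A)
    then have "\<exists>r L. strict_mono r \<and> (\<forall>a\<in>A. (\<lambda>n. X (r n) a) \<longlonglongrightarrow> L a)" by simp
    then obtain r L where r: "strict_mono r" "\<And>a. a \<in> A \<Longrightarrow> (\<lambda>n. X (r n) a) \<longlonglongrightarrow> L a" by metis
    have "\<forall>n. X (r n) a \<in> {l..u}" using insert.prems by blast
    from seq_compactE[OF compact_imp_seq_compact[OF compact_Icc] this]
    obtain b r' where r': "strict_mono r'" "((\<lambda>n. X (r n) a) \<circ> r') \<longlonglongrightarrow> b"
      by metis
    have "(\<lambda>n. X ((r \<circ> r') n) a') \<longlonglongrightarrow> (L(a := b)) a'" if "a' \<in> insert a A" for a'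
      using that r' LIMSEQ_subseq_LIMSEQ[OF r(2) r'(1), of a'] by (auto simp: o_def)
    moreover have "strict_mono (r \<circ> r')" using r(1) r'(1) by (rule strict_mono_o)
    ultimately show ?case by blast
  qed
  with that show thesis by blast
qed

context tree_flow
begin

lemma flow_le_1:
  assumes "0 \<le> t" "e \<in> E"
  shows "w t e \<le> 1"
  unfolding sum_flow[OF assms(1), symmetric]
  by (rule member_le_sum) (use assms flow_pos finite_E in \<open>auto simp: less_imp_le\<close>)

text \<open>The common scale cancels in \<open>log_flow t e - log_flow t f\<close>, the logarithm of
  the ratio of the two weights. Half the curvature gap serves as \<delta>, so the slope is
  eventually below \<open>- \<delta>\<close>; since \<open>w t f \<le> 1\<close>, decay of the ratio
  is decay of \<open>w t e\<close>.\<close>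

lemma flow_tendsto_0:
  assumes e: "e \<in> E" "f \<in> E" and less: "limit_curvature V E w f < limit_curvature V E w e"
  shows "((\<lambda>t. w t e) \<longlongrightarrow> 0) at_top"
proof -
  define \<delta> where "\<delta> = (limit_curvature V E w e - limit_curvature V E w f) / 2"
  have \<delta>: "0 < \<delta>" "\<delta> < limit_curvature V E w e - limit_curvature V E w f"
    using less by (auto simp: \<delta>_def)
  have "\<forall>\<^sub>F t in at_top. \<delta> < curvature V E (w t) e - curvature V E (w t) f"
    by (rule order_tendstoD[OF tendsto_diff[OF curvature_tendsto curvature_tendsto]]) (use e \<delta> in auto)
  with eventually_ge_at_top[of 0]
  have "\<forall>\<^sub>F t in at_top. 0 \<le> t \<and> \<delta> < curvature V E (w t) e - curvature V E (w t) f"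
    by (rule eventually_conj)
  then obtain T where T: "\<And>t. T \<le> t \<Longrightarrow> 0 \<le> t \<and> \<delta> < curvature V E (w t) e - curvature V E (w t) f"
    by (auto simp: eventually_at_top_linorder)
  let ?L = "\<lambda>t. log_flow t e - log_flow t f"
  have decay: "?L (h + T) \<le> ?L T - \<delta> * h" if "0 \<le> h" for h
  proof -
    have "?L (h + T) + \<delta> * h \<le> ?L (0 + T) + \<delta> * 0"
    proof (rule nonincreasing_on_halfline[where f = "\<lambda>h. ?L (h + T) + \<delta> * h"
          and f' = "\<lambda>h. (- curvature V E (w (h + T)) e - - curvature V E (w (h + T)) f) + \<delta> * 1"])
      fix h :: real assume h: "0 \<le> h"
      show "((\<lambda>h. ?L (h + T) + \<delta> * h) has_real_derivative
          (- curvature V E (w (h + T)) e - - curvature V E (w (h + T)) f) + \<delta> * 1) (at h within {0..})"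
        using h T[of T] T[of "h + T"] e
        by (intro DERIV_add DERIV_diff DERIV_cmult DERIV_ident DERIV_shift_halfline log_flow_derivative) auto
      show "(- curvature V E (w (h + T)) e - - curvature V E (w (h + T)) f) + \<delta> * 1 \<le> 0"
        using T[of "h + T"] h by simp
    qed (use that in auto)
    then show ?thesis by simp
  qed
  have "\<forall>\<^sub>F t in at_top. norm (w t e) \<le> exp (?L T + \<delta> * T) * exp (- (\<delta> * t))"
    using eventually_ge_at_top[of T]
  proof eventually_elim
    case (elim t)
    then have t: "0 \<le> t" using T by simp
    have "w t e = w t f * exp (?L t)"
      using flow_pos[OF t e(1)] flow_pos[OF t e(2)] by (simp add: log_flow_def exp_diff)
    also have "\<dots> \<le> 1 * exp (?L t)"
      using flow_le_1[OF t e(2)] by (intro mult_right_mono) auto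
    also have "\<dots> \<le> exp (?L T + \<delta> * T + - (\<delta> * t))"
      using decay[of "t - T"] elim by (simp add: algebra_simps)
    also have "\<dots> = exp (?L T + \<delta> * T) * exp (- (\<delta> * t))" by (rule exp_add)
    finally show ?case using flow_pos[OF t e(1)] by simp
  qed
  moreover have "((\<lambda>t. exp (?L T + \<delta> * T) * exp (- (\<delta> * t))) \<longlongrightarrow> 0) at_top"
    by (intro tendsto_mult_right_zero filterlim_compose[OF exp_at_bot])
      (use filterlim_tendsto_pos_mult_at_top[OF tendsto_const \<delta>(1) filterlim_ident] in
        \<open>simp add: filterlim_uminus_at_bot\<close>)
  ultimately show ?thesis by (rule Lim_null_comparison)
qed

lemma omega_limit_supported_on_min_curvature:
  assumes "omega_limit_point E w q"
  shows "positive_support E q \<subseteq> min_curvature_edges V E w"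
proof
  fix e assume "e \<in> positive_support E q"
  then have e: "e \<in> E" "0 < q e" by (auto simp: positive_support_def)
  obtain \<tau> where \<tau>: "filterlim \<tau> at_top sequentially" "(\<lambda>j. w (\<tau> j) e) \<longlonglongrightarrow> q e"
    using assms e by (auto simp: omega_limit_point_def)
  have "min_limit_curvature V E w \<in> limit_curvature V E w ` E"
    unfolding min_limit_curvature_def using finite_E edges by (intro Min_in) auto
  then obtain f where f: "f \<in> E" "limit_curvature V E w f = min_limit_curvature V E w" by auto
  have "\<not> limit_curvature V E w f < limit_curvature V E w e"
  proof
    assume "limit_curvature V E w f < limit_curvature V E w e"
    from filterlim_compose[OF flow_tendsto_0[OF e(1) f(1) this] \<tau>(1)] \<tau>(2) have "q e = 0"
      by (rule LIMSEQ_unique[symmetric])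
    with e show False by simp
  qed
  moreover have "min_limit_curvature V E w \<le> limit_curvature V E w e"
    unfolding min_limit_curvature_def using finite_E e by (intro Min_le) auto
  ultimately show "e \<in> min_curvature_edges V E w"
    using e f by (simp add: min_curvature_edges_def)
qed

text \<open>
  At a vertex with an incident edge outside the support, the weighted degree blows up, so the
  curvature contribution of this vertex vanishes in the limit.
\<close>

lemma curvature_tendsto_face_curvature:
  assumes pos: "\<forall>\<^sub>F j in sequentially. positive_metric E (u j)"
    and lim: "\<And>f. f \<in> E \<Longrightarrow> (\<lambda>j. u j f) \<longlonglongrightarrow> q f"
    and q: "\<And>f. f \<in> E \<Longrightarrow> 0 \<le> q f" and C: "C = positive_support E q" and e: "e \<in> C"
  shows "(\<lambda>j. face_curvature E E (u j) e) \<longlonglongrightarrow> face_curvature E C q e"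
proof -
  have eE: "e \<in> E" and qe: "0 < q e" using e by (auto simp: C positive_support_def)
  have fin: "finite (incident E x)" for x using finite_E by (simp add: incident_def)
  have fine: "finite e"
    using simple eE finite_V by (fastforce simp: simple_graph_def)
  have "(\<lambda>j. (2 - real (degree E x)) / (u j e * weighted_degree E (u j) x)) \<longlonglongrightarrow>
      (if incident E x \<subseteq> C then (2 - real (degree E x)) / (q e * weighted_degree E q x) else 0)"
    if x: "x \<in> e" for x
  proof (cases "incident E x \<subseteq> C")
    case True
    have posq: "0 < q f" if "f \<in> incident E x" for f
      using True that by (auto simp: C positive_support_def)
    have "0 < weighted_degree E q x"
      unfolding weighted_degree_def
      by (rule sum_pos2[of _ e]) (use posq fin eE x in \<open>auto simp: incident_def less_imp_le\<close>)
    then have "(\<lambda>j. (2 - real (degree E x)) / (u j e * weighted_degree E (u j) x)) \<longlonglongrightarrow>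
        (2 - real (degree E x)) / (q e * weighted_degree E q x)"
      unfolding weighted_degree_def using qe eE posq
      by (intro tendsto_intros lim) (auto simp: incident_def order_less_le)
    with True show ?thesis by simp
  next
    case False
    then obtain f where f: "f \<in> incident E x" "f \<in> E" "f \<notin> C" by (auto simp: incident_def)
    then have qf: "q f = 0" using q[of f] by (auto simp: C positive_support_def)
    \<comment> \<open>The single summand \<open>1 / u j f\<close> already bounds the weighted degree
      from below, and the resulting majorant tends to a multiple of
      \<open>q f / q e = 0\<close>.\<close>
    have "\<forall>\<^sub>F j in sequentially. norm ((2 - real (degree E x)) / (u j e * weighted_degree E (u j) x)) \<le>
        \<bar>2 - real (degree E x)\<bar> * u j f / u j e"
      using pos
    proof eventually_elim
      case (elim j)
      have p: "0 < u j f" "0 < u j e" using elim f eE by (auto simp: positive_metric_def)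
      have "1 / u j f \<le> weighted_degree E (u j) x"
        unfolding weighted_degree_def
        by (rule member_le_sum)
          (use f fin elim in \<open>auto simp: incident_def positive_metric_def less_imp_le\<close>)
      then have "u j e / u j f \<le> u j e * weighted_degree E (u j) x"
        using mult_left_mono[of "1 / u j f" "weighted_degree E (u j) x" "u j e"] p by simp
      then have "\<bar>2 - real (degree E x)\<bar> / (u j e * weighted_degree E (u j) x) \<le>
          \<bar>2 - real (degree E x)\<bar> / (u j e / u j f)"
        using p by (intro divide_left_mono mult_pos_pos divide_pos_pos)
          (auto intro: weighted_degree_pos[OF finite_E elim eE x])
      moreover have "0 < weighted_degree E (u j) x"
        by (rule weighted_degree_pos[OF finite_E elim eE x])
      ultimately show ?case using p by (simp add: abs_mult)
    qed
    moreover have "(\<lambda>j. \<bar>2 - real (degree E x)\<bar> * u j f / u j e) \<longlonglongrightarrow>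
        \<bar>2 - real (degree E x)\<bar> * q f / q e"
      using qe by (intro tendsto_intros lim f eE) auto
    then have "(\<lambda>j. \<bar>2 - real (degree E x)\<bar> * u j f / u j e) \<longlonglongrightarrow> 0" by (simp add: qf)
    ultimately have "(\<lambda>j. (2 - real (degree E x)) / (u j e * weighted_degree E (u j) x)) \<longlonglongrightarrow> 0"
      by (rule Lim_null_comparison)
    with False show ?thesis by simp
  qed
  then have "(\<lambda>j. face_curvature E E (u j) e) \<longlonglongrightarrow>
      (\<Sum>x\<in>e. if incident E x \<subseteq> C then (2 - real (degree E x)) / (q e * weighted_degree E q x) else 0)"
    unfolding face_curvature_all_edges by (rule tendsto_sum)
  also have "(\<Sum>x\<in>e. if incident E x \<subseteq> C then (2 - real (degree E x)) / (q e * weighted_degree E q x) else 0) =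
      face_curvature E C q e"
    using fine by (simp add: face_curvature_def weighted_degree_def sum.inter_filter cong: if_cong)
  finally show ?thesis .
qed

lemma omega_limit_face_solution:
  assumes "omega_limit_point E w q" and C: "C = positive_support E q"
  shows "restriction q C \<in> face_solutions E C (min_limit_curvature V E w)"
proof -
  obtain \<tau> where \<tau>: "filterlim \<tau> at_top sequentially" "\<And>e. e \<in> E \<Longrightarrow> (\<lambda>j. w (\<tau> j) e) \<longlonglongrightarrow> q e"
    using assms by (auto simp: omega_limit_point_def)
  have q: "\<And>e. e \<in> E \<Longrightarrow> 0 \<le> q e" "(\<Sum>e\<in>E. q e) = 1"
    using assms by (auto simp: omega_limit_point_def closed_simplex_def)
  have CE: "C \<subseteq> E" by (auto simp: C positive_support_def)
  have \<tau>0: "\<forall>\<^sub>F j in sequentially. 0 \<le> \<tau> j"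
    using \<tau>(1) by (simp add: filterlim_at_top)
  have "(\<Sum>e\<in>C. q e) = 1"
    unfolding q(2)[symmetric] using finite_E CE q(1)
    by (intro sum.mono_neutral_left) (auto simp: C positive_support_def not_less intro: order_antisym)
  then have "restriction q C \<in> open_simplex C"
    by (auto simp: open_simplex_def restriction_def C positive_support_def)
  moreover have "face_curvature E C (restriction q C) e = min_limit_curvature V E w" if e: "e \<in> C" for e
  proof -
    have eE: "e \<in> E" using e CE by blast
    have "(\<lambda>j. face_curvature E E (w (\<tau> j)) e) \<longlonglongrightarrow> face_curvature E C q e"
      by (rule curvature_tendsto_face_curvature[OF _ \<tau>(2) q(1) C e])
        (rule eventually_mono[OF \<tau>0 positive_flow])
    then have "(\<lambda>j. curvature V E (w (\<tau> j)) e) \<longlonglongrightarrow> face_curvature E C q e"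
      by (rule Lim_transform_eventually)
        (rule eventually_mono[OF \<tau>0], simp add: curvature_flow eE)
    moreover have "(\<lambda>j. curvature V E (w (\<tau> j)) e) \<longlonglongrightarrow> limit_curvature V E w e"
      by (rule filterlim_compose[OF curvature_tendsto[OF eE] \<tau>(1)])
    moreover have "limit_curvature V E w e = min_limit_curvature V E w"
      using omega_limit_supported_on_min_curvature[OF assms(1)] e
      by (auto simp: C min_curvature_edges_def)
    ultimately have "face_curvature E C q e = min_limit_curvature V E w"
      using LIMSEQ_unique by metis
    \<comment> \<open>Vertices counted by \<open>face_curvature\<close> have all their edges in
      \<open>C\<close>, where the restriction agrees with \<open>q\<close>.\<close>
    moreover have "face_curvature E C (restriction q C) e = face_curvature E C q e"
      unfolding face_curvature_def
      by (intro sum.cong refl arg_cong2[where f = "(/)"] arg_cong2[where f = "(*)"])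
        (auto simp: restriction_def e)
    ultimately show ?thesis by simp
  qed
  ultimately show ?thesis by (simp add: face_solutions_def)
qed

section \<open>From finitely many omega-limit points to convergence\<close>

lemma omega_limit_point_of_subsequence:
  assumes \<tau>: "filterlim \<tau> at_top sequentially" "\<And>j. 0 \<le> \<tau> j"
  obtains r q where "strict_mono r" "omega_limit_point E w q"
    "\<And>e. e \<in> E \<Longrightarrow> (\<lambda>j. w (\<tau> (r j)) e) \<longlonglongrightarrow> q e"
proof -
  have bounds: "w (\<tau> j) e \<in> {0..1}" if "e \<in> E" for j e
    using flow_pos flow_le_1 \<tau>(2) that by (simp add: less_imp_le)
  obtain r L where r: "strict_mono r" "\<And>e. e \<in> E \<Longrightarrow> (\<lambda>j. w (\<tau> (r j)) e) \<longlonglongrightarrow> L e"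
    using finite_family_convergent_subsequence[where X = "\<lambda>j. w (\<tau> j)", OF finite_E bounds] by metis
  \<comment> \<open>Values off \<open>E\<close> are set to 0, as membership in
    \<open>closed_simplex E\<close> demands.\<close>
  define q where "q = restriction L E"
  have lim: "(\<lambda>j. w (\<tau> (r j)) e) \<longlonglongrightarrow> q e" if "e \<in> E" for e
    using r(2)[OF that] that by (simp add: q_def restriction_def)
  have "0 \<le> q e" if "e \<in> E" for e
    by (rule LIMSEQ_le_const[OF lim[OF that]]) (use flow_pos \<tau>(2) that in \<open>auto simp: less_imp_le\<close>)
  moreover have "(\<Sum>e\<in>E. q e) = 1"
  proof -
    have "(\<lambda>j. \<Sum>e\<in>E. w (\<tau> (r j)) e) \<longlonglongrightarrow> (\<Sum>e\<in>E. q e)" by (intro tendsto_sum lim)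
    moreover have "(\<Sum>e\<in>E. w (\<tau> (r j)) e) = 1" for j by (rule sum_flow[OF \<tau>(2)])
    ultimately show ?thesis by (simp add: LIMSEQ_const_iff)
  qed
  ultimately have "q \<in> closed_simplex E" by (auto simp: closed_simplex_def q_def restriction_def)
  moreover have "filterlim (\<lambda>j. \<tau> (r j)) at_top sequentially"
    by (rule filterlim_compose[OF \<tau>(1) filterlim_subseq[OF r(1)]])
  ultimately have "omega_limit_point E w q"
    using lim unfolding omega_limit_point_def by (intro conjI exI[of _ "\<lambda>j. \<tau> (r j)"]) auto
  with that r(1) lim show thesis by blast
qed

text \<open>
  A coordinate that does not converge to the coordinate \<open>q e\<close> of an omega-limit point takes, by the
  intermediate value theorem, every small distance to \<open>q e\<close> at arbitrarily large times, and each
  of these distances is realized by another omega-limit point.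
\<close>

lemma flow_converges_if_finite_omega_limit:
  assumes fin: "finite {q. omega_limit_point E w q}"
  shows "flow_converges E w"
proof -
  obtain r q where r: "strict_mono r" and q: "omega_limit_point E w q"
    and lim: "\<And>e. e \<in> E \<Longrightarrow> (\<lambda>j. w (real (r j)) e) \<longlonglongrightarrow> q e"
    using omega_limit_point_of_subsequence[OF filterlim_real_sequentially] by auto
  have "((\<lambda>t. w t e) \<longlongrightarrow> q e) at_top" if e: "e \<in> E" for e
  proof (rule ccontr)
    let ?g = "\<lambda>t. \<bar>w t e - q e\<bar>"
    assume "\<not> ((\<lambda>t. w t e) \<longlongrightarrow> q e) at_top"
    then obtain \<epsilon> where \<epsilon>: "0 < \<epsilon>" "\<And>T. \<exists>t\<ge>T. \<epsilon> \<le> ?g t"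
      by (auto simp: tendsto_iff eventually_at_top_linorder dist_real_def not_less)
    have "\<exists>q'. omega_limit_point E w q' \<and> \<bar>q' e - q e\<bar> = c" if c: "c \<in> {0<..<\<epsilon>}" for c
    proof -
      have "\<exists>t\<ge>real n. ?g t = c" for n
      proof -
        \<comment> \<open>The times \<open>real (r j)\<close>, at which the coordinate returns to
          \<open>q e\<close>, supply the small end for the intermediate value theorem; a later time
          from \<open>\<epsilon>(2)\<close> supplies the large one.\<close>
        have "(\<lambda>j. ?g (real (r j))) \<longlonglongrightarrow> \<bar>q e - q e\<bar>"
          by (intro tendsto_intros lim e)
        then have "\<forall>\<^sub>F j in sequentially. ?g (real (r j)) < c"
          using c by (intro order_tendstoD) auto
        then have "\<forall>\<^sub>F j in sequentially. n \<le> j \<and> ?g (real (r j)) < c"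
          by (intro eventually_conj eventually_ge_at_top)
        then obtain j where j: "n \<le> j" "?g (real (r j)) < c"
          by (auto dest: eventually_happens)
        have n: "real n \<le> real (r j)" using j(1) seq_suble[OF r, of j] by simp
        obtain b where b: "real (r j) \<le> b" "\<epsilon> \<le> ?g b" using \<epsilon>(2) by blast
        have "continuous_on {real (r j)..b} ?g"
          by (intro continuous_intros continuous_on_subset[OF continuous_flow[OF e]]) auto
        from IVT'[OF _ _ b(1) this, of c] obtain t where t: "real (r j) \<le> t" "?g t = c"
          using j(2) b(2) c by auto
        have "real n \<le> t" using n t(1) by linarith
        with t(2) show ?thesis by blast
      qed
      then obtain \<tau> where \<tau>: "\<And>n. real n \<le> \<tau> n" "\<And>n. ?g (\<tau> n) = c" by metis
      have "filterlim \<tau> at_top sequentially"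
        by (rule filterlim_at_top_mono[OF filterlim_real_sequentially]) (use \<tau>(1) in auto)
      moreover have "0 \<le> \<tau> n" for n using \<tau>(1)[of n] by linarith
      ultimately obtain r' q' where q': "omega_limit_point E w q'"
          "\<And>e. e \<in> E \<Longrightarrow> (\<lambda>j. w (\<tau> (r' j)) e) \<longlonglongrightarrow> q' e"
        using omega_limit_point_of_subsequence by metis
      have "(\<lambda>j. ?g (\<tau> (r' j))) \<longlonglongrightarrow> \<bar>q' e - q e\<bar>" by (intro tendsto_intros q' e)
      then have "\<bar>q' e - q e\<bar> = c"
        unfolding \<tau>(2) using LIMSEQ_unique[OF tendsto_const] by metis
      with q'(1) show ?thesis by blast
    qed
    then have "{0<..<\<epsilon>} \<subseteq> (\<lambda>q'. \<bar>q' e - q e\<bar>) ` {q. omega_limit_point E w q}" by blast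
    then have "finite {0<..<\<epsilon>}" using fin by (meson finite_imageI finite_subset)
    then show False using \<epsilon>(1) infinite_Ioo by blast
  qed
  then show ?thesis by (auto simp: flow_converges_def)
qed

text \<open>Total mass 1 survives in the limit, so the support is nonempty; a limit point vanishes
  off its support and so equals its own restriction.\<close>

lemma omega_limit_in_face_solutions:
  assumes "omega_limit_point E w q"
  obtains C where "C \<noteq> {}" "C \<subseteq> min_curvature_edges V E w"
    "q \<in> face_solutions E C (min_limit_curvature V E w)"
proof (rule that)
  let ?C = "positive_support E q"
  have q: "\<And>e. e \<in> E \<Longrightarrow> 0 \<le> q e" "\<And>e. e \<notin> E \<Longrightarrow> q e = 0" "(\<Sum>e\<in>E. q e) = 1"
    using assms by (auto simp: omega_limit_point_def closed_simplex_def)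
  show "?C \<noteq> {}"
  proof
    assume "?C = {}"
    then have "(\<Sum>e\<in>E. q e) \<le> 0" by (intro sum_nonpos) (auto simp: positive_support_def not_less)
    then show False using q(3) by simp
  qed
  show "?C \<subseteq> min_curvature_edges V E w"
    by (rule omega_limit_supported_on_min_curvature[OF assms])
  have "restriction q ?C = q"
  proof
    fix e
    show "restriction q ?C e = q e"
      using q(1,2)[of e] by (cases "e \<in> E") (auto simp: restriction_def positive_support_def)
  qed
  then show "q \<in> face_solutions E ?C (min_limit_curvature V E w)"
    using omega_limit_face_solution[OF assms refl] by simp
qed

lemma flow_converges_if_finite_face_solutions:
  assumes "finite (\<Union>C \<in> {C. C \<noteq> {} \<and> C \<subseteq> min_curvature_edges V E w}.
    face_solutions E C (min_limit_curvature V E w))"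
  shows "flow_converges E w"
proof (rule flow_converges_if_finite_omega_limit, rule finite_subset[OF _ assms], rule subsetI)
  fix q assume "q \<in> {q. omega_limit_point E w q}"
  then have "omega_limit_point E w q" by simp
  then obtain C where "C \<noteq> {}" "C \<subseteq> min_curvature_edges V E w"
      "q \<in> face_solutions E C (min_limit_curvature V E w)"
    by (rule omega_limit_in_face_solutions)
  then show "q \<in> (\<Union>C \<in> {C. C \<noteq> {} \<and> C \<subseteq> min_curvature_edges V E w}.
      face_solutions E C (min_limit_curvature V E w))"
    by (intro UN_I[of C]) auto
qed

end

theorem theorem1p4:
  fixes V :: "'a set" and E :: "'a set set" and w :: "real \<Rightarrow> 'a set \<Rightarrow> real"
  assumes "finite_tree V E" and "E \<noteq> {}" and "normalized_flow V E w"
  shows "(\<forall>q C. omega_limit_point E w q \<and> C = positive_support E q \<longrightarrow>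
            C \<subseteq> min_curvature_edges V E w \<and>
            restriction q C \<in> face_solutions E C (min_limit_curvature V E w)) \<and>
         (finite (\<Union>C \<in> {C. C \<noteq> {} \<and> C \<subseteq> min_curvature_edges V E w}.
                    face_solutions E C (min_limit_curvature V E w))
            \<longrightarrow> flow_converges E w) \<and>
         ((\<forall>C. C \<noteq> {} \<and> C \<subseteq> min_curvature_edges V E w \<longrightarrow>
              (\<forall>p \<in> face_solutions E C (min_limit_curvature V E w).
               \<forall>p' \<in> face_solutions E C (min_limit_curvature V E w). p = p'))
            \<longrightarrow> flow_converges E w)"
proof -
  interpret tree_flow V E w using assms by unfold_locales
  show ?thesis
  proof (intro conjI impI)
    show "\<forall>q C. omega_limit_point E w q \<and> C = positive_support E q \<longrightarrow>
        C \<subseteq> min_curvature_edges V E w \<and>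
        restriction q C \<in> face_solutions E C (min_limit_curvature V E w)"
      by (simp add: omega_limit_supported_on_min_curvature omega_limit_face_solution)
  next
    assume "finite (\<Union>C \<in> {C. C \<noteq> {} \<and> C \<subseteq> min_curvature_edges V E w}.
      face_solutions E C (min_limit_curvature V E w))"
    then show "flow_converges E w" by (rule flow_converges_if_finite_face_solutions)
  next
    assume unique: "\<forall>C. C \<noteq> {} \<and> C \<subseteq> min_curvature_edges V E w \<longrightarrow>
      (\<forall>p \<in> face_solutions E C (min_limit_curvature V E w).
       \<forall>p' \<in> face_solutions E C (min_limit_curvature V E w). p = p')"
    \<comment> \<open>There are finitely many faces, each contributing at most one point.\<close>
    have "finite (min_curvature_edges V E w)"
      using finite_E by (simp add: min_curvature_edges_def)
    then have "finite {C. C \<noteq> {} \<and> C \<subseteq> min_curvature_edges V E w}" by simp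
    moreover have "finite (face_solutions E C (min_limit_curvature V E w))"
      if "C \<in> {C. C \<noteq> {} \<and> C \<subseteq> min_curvature_edges V E w}" for C
    proof -
      have eq: "p = p'" if "p \<in> face_solutions E C (min_limit_curvature V E w)"
          "p' \<in> face_solutions E C (min_limit_curvature V E w)" for p p'
        using unique[rule_format, of C p p'] \<open>C \<in> _\<close> that by simp
      show ?thesis
      proof (cases "face_solutions E C (min_limit_curvature V E w) = {}")
        case False
        then obtain p where "p \<in> face_solutions E C (min_limit_curvature V E w)" by auto
        then have "face_solutions E C (min_limit_curvature V E w) \<subseteq> {p}" using eq by auto
        then show ?thesis by (rule finite_subset) simp
      qed simp
    qed
    ultimately have "finite (\<Union>C \<in> {C. C \<noteq> {} \<and> C \<subseteq> min_curvature_edges V E w}.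
        face_solutions E C (min_limit_curvature V E w))"
      by (rule finite_UN_I)
    then show "flow_converges E w" by (rule flow_converges_if_finite_face_solutions)
  qed
qed

end
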